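(* Let $\tau\in\mathrm{Aut}^*(K)$ and let $\phi_\tau=\phi\circ\tau$ be a twisted rational map with $\phi\in K(z)$, $\deg\phi\ge 1$. Then $$\mathcal F_I(\phi_\tau)\subseteq \mathcal F(\phi_\tau)\cap\mathbb P^1\quad\text{and}\quad \mathcal J_I(\phi_\tau)\supseteq\mathcal J(\phi_\tau)\cap\mathbb P^1.$$ Moreover, if $\lambda_\tau\ge 1$, then $$\mathcal F_I(\phi_\tau)= \mathcal F(\phi_\tau)\cap\mathbb P^1\quad\text{and}\quad \mathcal J_I(\phi_\tau)=\mathcal J(\phi_\tau)\cap\mathbb P^1.$$
   Context: $K$ is an algebraically closed field of characteristic $0$, complete with respect to a non-trivial non-archimedean absolute value $|\cdot|$. $\mathrm{Aut}^*(K)$ is the group of continuous field automorphisms $\tau$ of $K$ for which there is a real number $\lambda_\tau>0$ with $|\tau(x)|=|x|^{\lambda_\tau}$ for all $x\in K$. $\mathbb P^1=\mathbb P^1(K)=K\cup\{\infty\}$, and $\mathsf P^1$ is the Berkovich projective line over $K$ with its weak topology; $\mathbb P^1\subset\mathsf P^1$ is the set of type I points. For $a\in K$, $r\ge0$, $\xi_{a,r}\in\mathsf P^1$ is the point corresponding to the closed disk $\{x\in K:|x-a|\le r\}$. Each $\tau\in\mathrm{Aut}^*(K)$ acts on $\mathbb P^1$ fixing $\infty$ and extends uniquely to a homeomorphism of $\mathsf P^1$, with $\tau(\xi_{a,r})=\xi_{\tau(a),r^{\lambda_\tau}}$. For $\phi\in K(z)$, the $\tau$-twisted rational map is $\phi_\tau=\phi\circ\tau$,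 acting on $\mathbb P^1$ and $\mathsf P^1$. The Berkovich Fatou set $\mathcal F(\phi_\tau)$ is the set of $\zeta\in\mathsf P^1$ having a neighborhood $U\subseteq\mathsf P^1$ such that $\bigcup_{n\ge0}\phi_\tau^n(U)$ omits infinitely many points of $\mathsf P^1$; the Berkovich Julia set is $\mathcal J(\phi_\tau)=\mathsf P^1\setminus\mathcal F(\phi_\tau)$. The classical Fatou set $\mathcal F_I(\phi_\tau)$ is the set of $x\in\mathbb P^1$ having a neighborhood in $\mathbb P^1$ on which $\{\phi_\tau^n\}_{n\ge0}$ is equicontinuous with respect to the spherical distance $\sigma$, where $\sigma(x,y)=\frac{|x-y|}{\max\{1,|x|\}\max\{1,|y|\}}$ for $x,y\in K$ (extended to $\infty$ as usual); the classical Julia set is $\mathcal J_I(\phi_\tau)=\mathbb P^1\setminus\mathcal F_I(\phi_\tau)$. *)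

theory Defs
  imports
    "HOL-Analysis.Analysis"
    "HOL-Computational_Algebra.Computational_Algebra"
begin

section \<open>The ground field\<close>

definition nonarch_abs :: "('a::field \<Rightarrow> real) \<Rightarrow> bool" where
  "nonarch_abs v \<longleftrightarrow>
     (\<forall>x. v x \<ge> 0) \<and> (\<forall>x. v x = 0 \<longleftrightarrow> x = 0) \<and>
     (\<forall>x y. v (x * y) = v x * v y) \<and> (\<forall>x y. v (x + y) \<le> max (v x) (v y))"

definition nontrivial_abs :: "('a::field \<Rightarrow> real) \<Rightarrow> bool" where
  "nontrivial_abs v \<longleftrightarrow> (\<exists>x. x \<noteq> 0 \<and> v x \<noteq> 1)"

abbreviation abs_dist :: "('a::field \<Rightarrow> real) \<Rightarrow> 'a \<Rightarrow> 'a \<Rightarrow> real" where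
  "abs_dist v x y \<equiv> v (x - y)"

definition complete_abs :: "('a::field \<Rightarrow> real) \<Rightarrow> bool" where
  "complete_abs v \<longleftrightarrow> Metric_space.mcomplete UNIV (abs_dist v)"

definition field_automorphism :: "('a::field \<Rightarrow> 'a) \<Rightarrow> bool" where
  "field_automorphism \<tau> \<longleftrightarrow>
     bij \<tau> \<and> \<tau> 1 = 1 \<and> (\<forall>x y. \<tau> (x + y) = \<tau> x + \<tau> y) \<and> (\<forall>x y. \<tau> (x * y) = \<tau> x * \<tau> y)"

definition Aut_star :: "('a::field \<Rightarrow> real) \<Rightarrow> ('a \<Rightarrow> 'a) set" where
  "Aut_star v = {\<tau>. field_automorphism \<tau> \<and>
     continuous_map (Metric_space.mtopology UNIV (abs_dist v))
                    (Metric_space.mtopology UNIV (abs_dist v)) \<tau> \<and>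
     (\<exists>l>0. \<forall>x. v (\<tau> x) = v x powr l)}"

text \<open>The exponent \<open>\<lambda>\<^sub>\<tau>\<close>; it is unique because the absolute value is nontrivial.\<close>

definition twist_exp :: "('a::field \<Rightarrow> real) \<Rightarrow> ('a \<Rightarrow> 'a) \<Rightarrow> real" where
  "twist_exp v \<tau> = (THE l. l > 0 \<and> (\<forall>x. v (\<tau> x) = v x powr l))"


section \<open>The projective line and its Berkovich version\<close>

text \<open>In both projective lines \<^term>\<open>None\<close> is the point at infinity.\<close>

type_synonym 'a proj_line = "'a option"

text \<open>The elements of the following type that are really points of the Berkovich projective
  line are those in \<open>topspace (berk_P1 v)\<close>.\<close>

type_synonym 'a berk = "('a poly \<Rightarrow> real) option"

definition mult_seminorm :: "('a::field \<Rightarrow> real) \<Rightarrow> ('a poly \<Rightarrow> real) \<Rightarrow> bool" where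
  "mult_seminorm v \<zeta> \<longleftrightarrow>
     (\<forall>f. \<zeta> f \<ge> 0) \<and> (\<forall>a. \<zeta> [:a:] = v a) \<and>
     (\<forall>f g. \<zeta> (f * g) = \<zeta> f * \<zeta> g) \<and> (\<forall>f g. \<zeta> (f + g) \<le> max (\<zeta> f) (\<zeta> g))"

text \<open>The weak (Gelfand) topology on the Berkovich affine line is the topology of pointwise
  convergence; the Berkovich projective line is its one-point compactification.\<close>

definition berk_A1 :: "('a::field \<Rightarrow> real) \<Rightarrow> ('a poly \<Rightarrow> real) topology" where
  "berk_A1 v = subtopology (powertop_real UNIV) {\<zeta>. mult_seminorm v \<zeta>}"

definition berk_P1 :: "('a::field \<Rightarrow> real) \<Rightarrow> 'a berk topology" where
  "berk_P1 v = Alexandroff_compactification (berk_A1 v)"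

definition typeI :: "('a::field \<Rightarrow> real) \<Rightarrow> 'a proj_line \<Rightarrow> 'a berk" where
  "typeI v = map_option (\<lambda>x f. v (poly f x))"

definition disk_point :: "('a::field \<Rightarrow> real) \<Rightarrow> 'a \<Rightarrow> real \<Rightarrow> 'a berk" where
  "disk_point v a r = Some (\<lambda>f. SUP x\<in>{x. v (x - a) \<le> r}. v (poly f x))"


section \<open>Rational maps\<close>

text \<open>A representation \<open>\<phi> = p / q\<close> in lowest terms, which is unique up to a nonzero constant
  factor; nothing below depends on that constant.\<close>

definition lowest_terms :: "'a::field poly fract \<Rightarrow> 'a poly \<times> 'a poly" where
  "lowest_terms \<phi> = (SOME (p, q). q \<noteq> 0 \<and> coprime p q \<and> \<phi> = Fract p q)"

abbreviation rat_num :: "'a::field poly fract \<Rightarrow> 'a poly" where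
  "rat_num \<phi> \<equiv> fst (lowest_terms \<phi>)"

abbreviation rat_den :: "'a::field poly fract \<Rightarrow> 'a poly" where
  "rat_den \<phi> \<equiv> snd (lowest_terms \<phi>)"

definition rat_degree :: "'a::field poly fract \<Rightarrow> nat" where
  "rat_degree \<phi> = max (degree (rat_num \<phi>)) (degree (rat_den \<phi>))"

definition rat_map :: "'a::field poly fract \<Rightarrow> 'a proj_line \<Rightarrow> 'a proj_line" where
  "rat_map \<phi> P =
     (let p = rat_num \<phi>; q = rat_den \<phi>; d = rat_degree \<phi>;
          (a, b) = (case P of None \<Rightarrow> (coeff p d, coeff q d) | Some x \<Rightarrow> (poly p x, poly q x))
      in if b = 0 then None else Some (a / b))"

text \<open>The numerator of \<open>f \<circ> (p / q)\<close> over the denominator \<open>q ^ degree f\<close>.\<close>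

definition subst_num :: "'a::field poly \<Rightarrow> 'a poly \<Rightarrow> 'a poly \<Rightarrow> 'a poly" where
  "subst_num p q f = (\<Sum>i\<le>degree f. smult (coeff f i) (p ^ i * q ^ (degree f - i)))"

text \<open>The action of \<open>\<phi>\<close> on the Berkovich projective line is \<open>\<parallel>f\<parallel>\<^bsub>\<phi>(\<zeta>)\<^esub> = \<parallel>f \<circ> \<phi>\<parallel>\<^bsub>\<zeta>\<^esub>\<close>, with
  \<open>\<phi>(\<zeta>) = \<infinity>\<close> if the denominator of \<open>\<phi>\<close> vanishes at \<open>\<zeta>\<close>.\<close>

definition berk_rat_map ::
    "('a::field \<Rightarrow> real) \<Rightarrow> 'a poly fract \<Rightarrow> 'a berk \<Rightarrow> 'a berk" where
  "berk_rat_map v \<phi> P = (case P of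
       None \<Rightarrow> typeI v (rat_map \<phi> None)
     | Some \<zeta> \<Rightarrow>
        (if \<zeta> (rat_den \<phi>) = 0 then None
         else Some (\<lambda>f. \<zeta> (subst_num (rat_num \<phi>) (rat_den \<phi>) f) / \<zeta> (rat_den \<phi>) ^ degree f)))"

text \<open>The action of \<open>\<tau>\<close> is \<open>\<parallel>f\<parallel>\<^bsub>\<tau>(\<zeta>)\<^esub> = \<parallel>\<tau>\<^sup>-\<^sup>1 f\<parallel>\<^bsub>\<zeta>\<^esub>\<close> raised to the power \<open>\<lambda>\<^sub>\<tau>\<close>, where \<open>\<tau>\<^sup>-\<^sup>1\<close>
  acts on coefficients. The lemmas \<open>berk_twist_typeI\<close>, \<open>berk_twist_disk_point\<close> and
  \<open>homeomorphic_map_berk_twist\<close> below show that this is the homeomorphism extending \<open>\<tau>\<close>.\<close>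

definition berk_twist ::
    "('a::field \<Rightarrow> real) \<Rightarrow> ('a \<Rightarrow> 'a) \<Rightarrow> 'a berk \<Rightarrow> 'a berk" where
  "berk_twist v \<tau> = map_option (\<lambda>\<zeta> f. \<zeta> (map_poly (inv \<tau>) f) powr twist_exp v \<tau>)"

definition twisted_map ::
    "'a::field poly fract \<Rightarrow> ('a \<Rightarrow> 'a) \<Rightarrow> 'a proj_line \<Rightarrow> 'a proj_line" where
  "twisted_map \<phi> \<tau> = rat_map \<phi> \<circ> map_option \<tau>"

definition berk_twisted_map ::
    "('a::field \<Rightarrow> real) \<Rightarrow> 'a poly fract \<Rightarrow> ('a \<Rightarrow> 'a) \<Rightarrow> 'a berk \<Rightarrow> 'a berk" where
  "berk_twisted_map v \<phi> \<tau> = berk_rat_map v \<phi> \<circ> berk_twist v \<tau>"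


section \<open>Fatou and Julia sets\<close>

definition neighborhood :: "'b topology \<Rightarrow> 'b \<Rightarrow> 'b set \<Rightarrow> bool" where
  "neighborhood X x U \<longleftrightarrow> U \<subseteq> topspace X \<and> (\<exists>V. openin X V \<and> x \<in> V \<and> V \<subseteq> U)"

definition berk_Fatou ::
    "('a::field \<Rightarrow> real) \<Rightarrow> 'a poly fract \<Rightarrow> ('a \<Rightarrow> 'a) \<Rightarrow> 'a berk set" where
  "berk_Fatou v \<phi> \<tau> = {\<zeta> \<in> topspace (berk_P1 v). \<exists>U. neighborhood (berk_P1 v) \<zeta> U \<and>
     infinite (topspace (berk_P1 v) - (\<Union>n. (berk_twisted_map v \<phi> \<tau> ^^ n) ` U))}"

definition berk_Julia ::
    "('a::field \<Rightarrow> real) \<Rightarrow> 'a poly fract \<Rightarrow> ('a \<Rightarrow> 'a) \<Rightarrow> 'a berk set" where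
  "berk_Julia v \<phi> \<tau> = topspace (berk_P1 v) - berk_Fatou v \<phi> \<tau>"

fun sph_dist :: "('a::field \<Rightarrow> real) \<Rightarrow> 'a proj_line \<Rightarrow> 'a proj_line \<Rightarrow> real" where
  "sph_dist v (Some x) (Some y) = v (x - y) / (max 1 (v x) * max 1 (v y))"
| "sph_dist v (Some x) None = 1 / max 1 (v x)"
| "sph_dist v None (Some y) = 1 / max 1 (v y)"
| "sph_dist v None None = 0"

definition sph_topology :: "('a::field \<Rightarrow> real) \<Rightarrow> 'a proj_line topology" where
  "sph_topology v = Metric_space.mtopology UNIV (sph_dist v)"

text \<open>Equicontinuity at every point of \<open>U\<close>; the \<open>\<delta>\<close> may depend on the point.\<close>

definition equicontinuous_on ::
    "('b \<Rightarrow> 'b \<Rightarrow> real) \<Rightarrow> (nat \<Rightarrow> 'b \<Rightarrow> 'b) \<Rightarrow> 'b set \<Rightarrow> bool" where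
  "equicontinuous_on d F U \<longleftrightarrow>
     (\<forall>x\<in>U. \<forall>\<epsilon>>0. \<exists>\<delta>>0. \<forall>n. \<forall>y\<in>U. d x y < \<delta> \<longrightarrow> d (F n x) (F n y) < \<epsilon>)"

definition classical_Fatou ::
    "('a::field \<Rightarrow> real) \<Rightarrow> 'a poly fract \<Rightarrow> ('a \<Rightarrow> 'a) \<Rightarrow> 'a proj_line set" where
  "classical_Fatou v \<phi> \<tau> = {x. \<exists>U. neighborhood (sph_topology v) x U \<and>
     equicontinuous_on (sph_dist v) (\<lambda>n. twisted_map \<phi> \<tau> ^^ n) U}"

definition classical_Julia ::
    "('a::field \<Rightarrow> real) \<Rightarrow> 'a poly fract \<Rightarrow> ('a \<Rightarrow> 'a) \<Rightarrow> 'a proj_line set" where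
  "classical_Julia v \<phi> \<tau> = UNIV - classical_Fatou v \<phi> \<tau>"


section \<open>Adequacy of the definitions\<close>

lemma nonarch_absD:
  assumes "nonarch_abs v"
  shows "v x \<ge> 0" "v x = 0 \<longleftrightarrow> x = 0" "v (x * y) = v x * v y" "v (x + y) \<le> max (v x) (v y)"
    "v 0 = 0" "v 1 = 1" "v (- x) = v x" "v (x - y) = v (y - x)" "v (x ^ n) = v x ^ n"
proof -
  show mult: "v (x * y) = v x * v y" for x y using assms unfolding nonarch_abs_def by blast
  show nn: "v x \<ge> 0" for x using assms unfolding nonarch_abs_def by blast
  show z: "v x = 0 \<longleftrightarrow> x = 0" for x using assms unfolding nonarch_abs_def by blast
  show "v (x + y) \<le> max (v x) (v y)" using assms unfolding nonarch_abs_def by blast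
  show "v 0 = 0" using z by blast
  show one: "v 1 = 1" using mult[of 1 1] z[of 1] by simp
  have "v (-1) * v (-1) = 1" using mult[of "-1" "-1"] one by simp
  hence "v (-1) = 1" using nn[of "-1"] by (metis abs_of_nonneg abs_square_eq_1 power2_eq_square)
  hence neg: "v (- x) = v x" for x using mult[of "-1" x] by simp
  thus "v (- x) = v x" .
  show "v (x - y) = v (y - x)" using neg[of "x - y"] by simp
  show "v (x ^ n) = v x ^ n" by (induction n) (simp_all add: one mult)
qed

lemma Metric_space_abs_dist:
  assumes "nonarch_abs v" shows "Metric_space UNIV (abs_dist v)"
proof
  fix x y z :: 'a
  note A = nonarch_absD[OF assms]
  show "0 \<le> v (x - y)" "v (x - y) = v (y - x)" "v (x - y) = 0 \<longleftrightarrow> x = y"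
    by (auto simp: A(1,2) A(8)[of x y])
  have "v (x - z) \<le> max (v (x - y)) (v (y - z))" using A(4)[of "x - y" "y - z"] by simp
  thus "v (x - z) \<le> v (x - y) + v (y - z)" using A(1)[of "x - y"] A(1)[of "y - z"] by linarith
qed

lemma Metric_space_sph_dist:
  assumes "nonarch_abs v" shows "Metric_space UNIV (sph_dist v)"
proof
  note A = nonarch_absD[OF assms]
  fix x y z :: "'a option"
  define m where "m = (\<lambda>x. max 1 (v x))"
  have m1: "m x \<ge> 1" and m0: "m x > 0" and mv: "v x \<le> m x" for x by (auto simp: m_def)
  have S: "sph_dist v (Some x) (Some y) = v (x - y) / (m x * m y)"
    "sph_dist v (Some x) None = 1 / m x" "sph_dist v None (Some x) = 1 / m x" for x y
    by (auto simp: m_def)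
  have sub: "v (a - b) \<le> max (v a) (v b)" for a b using A(4)[of a "-b"] A(7)[of b] by simp
  show nn: "0 \<le> sph_dist v x y" for x y
    by (cases x; cases y) (auto simp: S A(1) less_imp_le[OF m0] simp del: sph_dist.simps(1-3))
  show "sph_dist v x y = sph_dist v y x"
    by (cases x; cases y) (auto simp: mult.commute A(8))
  show "sph_dist v x y = 0 \<longleftrightarrow> x = y"
    using m0 by (cases x; cases y) (auto simp: S A(2) less_imp_neq[symmetric] simp del: sph_dist.simps(1-3))
  have tri: "v (a - c) * m b \<le> v (a - b) * m c + v (b - c) * m a" for a b c
  proof (cases "v b \<le> 1")
    case True
    have "v (a - c) \<le> max (v (a - b)) (v (b - c))" using A(4)[of "a - b" "b - c"] by simp
    also have "\<dots> \<le> v (a - b) + v (b - c)" using A(1) by simp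
    also have "\<dots> \<le> v (a - b) * m c + v (b - c) * m a"
      using mult_left_mono[OF m1[of c] A(1)[of "a - b"]] mult_left_mono[OF m1[of a] A(1)[of "b - c"]] by simp
    finally show ?thesis using True by (simp add: m_def)
  next
    case False
    have "v (a - c) * m b = v ((a - b) * c + (b - c) * a)"
      using False by (simp add: m_def A(3)[symmetric]) (simp add: algebra_simps)
    also have "\<dots> \<le> max (v ((a - b) * c)) (v ((b - c) * a))" by (rule A(4))
    also have "\<dots> \<le> v (a - b) * v c + v (b - c) * v a" using A(1) by (simp add: A(3))
    also have "\<dots> \<le> v (a - b) * m c + v (b - c) * m a"
      using mult_left_mono[OF mv[of c] A(1)[of "a - b"]] mult_left_mono[OF mv[of a] A(1)[of "b - c"]] by simp
    finally show ?thesis .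
  qed
  have le2: "v (a - b) \<le> m a * m b" for a b
    using sub[of a b] mult_mono[OF mv[of a] m1[of b]] mult_mono[OF m1[of a] mv[of b]]
      m0[of a] m0[of b] A(1) by (simp add: max_def split: if_splits)
  have t2: "m b \<le> v (a - b) + m a" for a b
    using A(4)[of "b - a" a] A(8)[of a b] A(1)[of "a - b"] mv[of a] m1[of a]
    by (simp add: m_def max_def split: if_splits)
  show "sph_dist v x z \<le> sph_dist v x y + sph_dist v y z"
  proof (cases x; cases y; cases z)
    fix a b c assume e: "x = Some a" "y = Some b" "z = Some c"
    show ?thesis using tri[of a c b] m0[of a] m0[of b] m0[of c]
      by (simp add: e S field_simps del: sph_dist.simps(1-3))
  next
    fix a c assume e: "x = Some a" "y = None" "z = Some c"
    have "v (a - c) \<le> m a + m c" using sub[of a c] mv[of a] mv[of c] m0[of a] m0[of c]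
      by linarith
    thus ?thesis using m0[of a] m0[of c] by (simp add: e S field_simps del: sph_dist.simps(1-3))
  next
    fix a b assume e: "x = Some a" "y = Some b" "z = None"
    show ?thesis using t2[of b a] m0[of a] m0[of b]
      by (simp add: e S field_simps del: sph_dist.simps(1-3))
  next
    fix b c assume e: "x = None" "y = Some b" "z = Some c"
    show ?thesis using t2[of b c] m0[of b] m0[of c] A(8)[of b c]
      by (simp add: e S field_simps del: sph_dist.simps(1-3))
  qed (use nn in auto)
qed

lemma mult_seminorm_typeI:
  assumes "nonarch_abs v" shows "mult_seminorm v (\<lambda>f. v (poly f x))"
  by (simp add: mult_seminorm_def nonarch_absD[OF assms])

lemma topspace_berk_A1: "topspace (berk_A1 v) = {\<zeta>. mult_seminorm v \<zeta>}"
  by (simp add: berk_A1_def)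

lemma topspace_berk_P1: "topspace (berk_P1 v) = insert None (Some ` {\<zeta>. mult_seminorm v \<zeta>})"
  by (simp add: berk_P1_def topspace_berk_A1)

lemma range_typeI_subset:
  assumes "nonarch_abs v" shows "range (typeI v) \<subseteq> topspace (berk_P1 v)"
  using mult_seminorm_typeI[OF assms]
  by (auto simp: topspace_berk_P1 typeI_def map_option_case split: option.splits)

lemma lowest_terms:
  shows "rat_den \<phi> \<noteq> 0" "coprime (rat_num \<phi>) (rat_den \<phi>)" "\<phi> = Fract (rat_num \<phi>) (rat_den \<phi>)"
proof -
  let ?P = "\<lambda>pq. snd pq \<noteq> 0 \<and> \<phi> = Fract (fst pq) (snd pq)"
  obtain a b where "?P (a, b)" by (cases \<phi>) auto
  then obtain pq where pq: "?P pq" and min: "\<And>z. ?P z \<Longrightarrow> degree (snd pq) \<le> degree (snd z)"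
    using ex_has_least_nat[of ?P "(a, b)" "\<lambda>z. degree (snd z)"] by blast
  obtain p q where e: "pq = (p, q)" by (cases pq)
  have "coprime p q"
  proof (rule coprimeI)
    fix c assume "c dvd p" "c dvd q"
    then obtain p' q' where c: "p = c * p'" "q = c * q'" by (auto elim!: dvdE)
    have nz: "c \<noteq> 0" "q' \<noteq> 0" using pq c e by auto
    have "?P (p', q')" using pq c e nz by (simp add: eq_fract)
    from min[OF this] have "degree c = 0" using c e nz by (simp add: degree_mult_eq)
    thus "is_unit c" using nz by (simp add: is_unit_iff_degree)
  qed
  hence "\<exists>z. case z of (p, q) \<Rightarrow> q \<noteq> 0 \<and> coprime p q \<and> \<phi> = Fract p q" using pq e by auto
  from someI_ex[OF this, folded lowest_terms_def]
  show "rat_den \<phi> \<noteq> 0" "coprime (rat_num \<phi>) (rat_den \<phi>)" "\<phi> = Fract (rat_num \<phi>) (rat_den \<phi>)"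
    by (auto simp: case_prod_unfold)
qed

lemma poly_subst_num:
  assumes "poly q x \<noteq> 0"
  shows "poly (subst_num p q f) x = poly f (poly p x / poly q x) * poly q x ^ degree f"
proof -
  have "poly (subst_num p q f) x =
        (\<Sum>i\<le>degree f. coeff f i * (poly p x / poly q x) ^ i * poly q x ^ degree f)"
    unfolding subst_num_def poly_sum
  proof (rule sum.cong)
    fix i assume "i \<in> {..degree f}"
    hence "poly q x ^ degree f = poly q x ^ i * poly q x ^ (degree f - i)"
      by (simp flip: power_add)
    thus "poly (smult (coeff f i) (p ^ i * q ^ (degree f - i))) x =
          coeff f i * (poly p x / poly q x) ^ i * poly q x ^ degree f"
      using assms by (simp add: power_divide)
  qed simp
  thus ?thesis by (simp add: poly_altdef sum_distrib_right)
qed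

lemma berk_rat_map_typeI:
  assumes v: "nonarch_abs v"
  shows "berk_rat_map v \<phi> (typeI v P) = typeI v (rat_map \<phi> P)"
proof (cases P)
  case None
  thus ?thesis by (simp add: berk_rat_map_def typeI_def)
next
  case (Some x)
  show ?thesis
  proof (cases "poly (rat_den \<phi>) x = 0")
    case True
    thus ?thesis using Some
      by (simp add: berk_rat_map_def typeI_def rat_map_def nonarch_absD[OF v])
  next
    case False
    thus ?thesis using Some
      by (auto simp: berk_rat_map_def typeI_def rat_map_def nonarch_absD[OF v] poly_subst_num fun_eq_iff)
  qed
qed

lemma twist_exp:
  assumes v: "nonarch_abs v" "nontrivial_abs v" and \<tau>: "\<tau> \<in> Aut_star v"
  shows "twist_exp v \<tau> > 0" "v (\<tau> x) = v x powr twist_exp v \<tau>"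
proof -
  obtain l where l: "l > 0" "\<And>x. v (\<tau> x) = v x powr l" using \<tau> by (auto simp: Aut_star_def)
  obtain c where c: "c \<noteq> 0" "v c \<noteq> 1" using v(2) by (auto simp: nontrivial_abs_def)
  have "v c > 0" using c(1) nonarch_absD(1,2)[OF v(1), of c] by linarith
  have "twist_exp v \<tau> = l"
    unfolding twist_exp_def
  proof (rule the_equality)
    fix l' assume "l' > 0 \<and> (\<forall>x. v (\<tau> x) = v x powr l')"
    hence "v c powr l' = v c powr l" using l(2)[of c] by simp
    thus "l' = l" using \<open>v c > 0\<close> c(2) by (simp add: powr_inj) 
  qed (use l in auto)
  thus "twist_exp v \<tau> > 0" "v (\<tau> x) = v x powr twist_exp v \<tau>" using l by auto
qed

lemma field_automorphismD:
  assumes "field_automorphism \<tau>"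
  shows "bij \<tau>" "\<tau> 1 = 1" "\<tau> (x + y) = \<tau> x + \<tau> y" "\<tau> (x * y) = \<tau> x * \<tau> y" "\<tau> 0 = 0"
    "\<tau> (x - y) = \<tau> x - \<tau> y"
proof -
  show "bij \<tau>" "\<tau> 1 = 1" and add: "\<tau> (x + y) = \<tau> x + \<tau> y" and "\<tau> (x * y) = \<tau> x * \<tau> y" for x y
    using assms by (auto simp: field_automorphism_def)
  have "\<tau> 0 + \<tau> 0 = \<tau> 0 + 0" using add[of 0 0] by (simp only: add_0_right)
  thus "\<tau> 0 = 0" by (rule add_left_imp_eq)
  show "\<tau> (x - y) = \<tau> x - \<tau> y" using add[of "x - y" y] by simp
qed

lemma field_automorphism_inv:
  assumes "field_automorphism \<tau>" shows "field_automorphism (inv \<tau>)"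
proof -
  note t = field_automorphismD[OF assms]
  have s: "\<tau> (inv \<tau> x) = x" for x by (meson bij_inv_eq_iff t(1))
  have i: "inv \<tau> y = x" if "\<tau> x = y" for x y using that by (metis bij_inv_eq_iff t(1))
  show ?thesis unfolding field_automorphism_def
    by (intro conjI allI i) (simp_all add: bij_imp_bij_inv t s)
qed

lemma poly_map_poly_automorphism:
  assumes "field_automorphism \<tau>"
  shows "poly (map_poly \<tau> f) (\<tau> x) = \<tau> (poly f x)"
  by (induction f)
     (simp_all add: map_poly_pCons field_automorphismD[OF assms])

lemma twist_typeI_aux:
  assumes v: "nonarch_abs v" "nontrivial_abs v" and \<tau>: "\<tau> \<in> Aut_star v"
  shows "v (poly (map_poly (inv \<tau>) f) x) powr twist_exp v \<tau> = v (poly f (\<tau> x))"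
proof -
  have a: "field_automorphism \<tau>" using \<tau> by (simp add: Aut_star_def)
  have "\<tau> (poly (map_poly (inv \<tau>) f) x) = poly (map_poly \<tau> (map_poly (inv \<tau>) f)) (\<tau> x)"
    by (simp add: poly_map_poly_automorphism[OF a])
  also have "map_poly \<tau> (map_poly (inv \<tau>) f) = f"
    using field_automorphismD[OF a] field_automorphismD[OF field_automorphism_inv[OF a]]
    by (intro poly_eqI) (simp add: coeff_map_poly bij_is_surj surj_f_inv_f)
  finally show ?thesis using twist_exp(2)[OF v \<tau>] by metis
qed

lemma berk_twist_typeI:
  assumes "nonarch_abs v" "nontrivial_abs v" and "\<tau> \<in> Aut_star v"
  shows "berk_twist v \<tau> (typeI v P) = typeI v (map_option \<tau> P)"
  by (cases P) (simp_all add: berk_twist_def typeI_def twist_typeI_aux[OF assms])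

lemma disk_bdd:
  assumes v: "nonarch_abs v"
  shows "bdd_above ((\<lambda>x. v (poly f x)) ` {x. v (x - a) \<le> r})"
proof -
  note A = nonarch_absD[OF v]
  have "\<exists>M\<ge>0. \<forall>x. v (x - a) \<le> r \<longrightarrow> v (poly f x) \<le> M"
  proof (induction f)
    case 0
    thus ?case by (auto simp: A)
  next
    case (pCons c f)
    then obtain M where M: "M \<ge> 0" "\<And>x. v (x - a) \<le> r \<Longrightarrow> v (poly f x) \<le> M" by auto
    let ?R = "max \<bar>r\<bar> (v a)"
    have "v (poly (pCons c f) x) \<le> max (v c) (?R * M)" if x: "v (x - a) \<le> r" for x
    proof -
      have "v x \<le> ?R" using A(4)[of "x - a" a] x by simp
      hence "v x * v (poly f x) \<le> ?R * M" by (rule mult_mono) (use M x A(1) in auto)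
      thus ?thesis using A(4)[of c "x * poly f x"] by (simp add: A(3))
    qed
    thus ?case using A(1)[of c] by (intro exI[of _ "max (v c) (?R * M)"]) auto
  qed
  thus ?thesis by (auto simp: bdd_above_def)
qed

lemma berk_twist_disk_point:
  assumes v: "nonarch_abs v" "nontrivial_abs v" and \<tau>: "\<tau> \<in> Aut_star v" and r: "r \<ge> 0"
  shows "berk_twist v \<tau> (disk_point v a r) = disk_point v (\<tau> a) (r powr twist_exp v \<tau>)"
proof -
  note A = nonarch_absD[OF v(1)]
  have aut: "field_automorphism \<tau>" using \<tau> by (simp add: Aut_star_def)
  note t = field_automorphismD[OF aut]
  define l where "l = twist_exp v \<tau>"
  have l: "l > 0" "\<And>x. v (\<tau> x) = v x powr l" using twist_exp[OF v \<tau>] by (auto simp: l_def)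
  let ?D = "{x. v (x - a) \<le> r}"
  have D: "\<tau> ` ?D = {x. v (x - \<tau> a) \<le> r powr l}"
  proof -
    have "v (\<tau> x - \<tau> a) \<le> r powr l \<longleftrightarrow> v (x - a) \<le> r" for x
      using powr_less_mono2[OF l(1) r] powr_mono2[OF less_imp_le[OF l(1)] A(1)[of "x - a"]]
      by (metis l(2) linorder_not_le t(6))
    thus ?thesis using bij_is_surj[OF t(1)] by (auto simp: image_iff) (metis surjD)
  qed
  have ne: "?D \<noteq> {}" using r A(5) by (auto intro: exI[of _ a])
  have "(SUP x\<in>?D. v (poly (map_poly (inv \<tau>) f) x)) powr l =
        (SUP x\<in>{x. v (x - \<tau> a) \<le> r powr l}. v (poly f x))" for f
  proof -
    let ?S = "(\<lambda>x. v (poly (map_poly (inv \<tau>) f) x)) ` ?D"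
    let ?p = "\<lambda>s. max 0 s powr l"
    have "isCont ?p s" for s :: real
      using l(1) by (intro continuous_intros) auto
    hence cont: "continuous (at_left (Sup ?S)) ?p" by (rule continuous_at_imp_continuous_at_within)
    have "mono ?p" using l(1) by (intro monoI powr_mono2) auto
    from continuous_at_Sup_mono[OF this cont _ disk_bdd[OF v(1)]]
    have "?p (Sup ?S) = (SUP s\<in>?S. ?p s)" using ne by auto
    also have "(SUP s\<in>?S. ?p s) = (SUP x\<in>?D. v (poly f (\<tau> x)))"
      using twist_typeI_aux[OF v \<tau>, of f] by (simp add: image_image A(1) l_def)
    also have "\<dots> = (SUP x\<in>\<tau> ` ?D. v (poly f x))" by (simp add: image_image)
    also have "?p (Sup ?S) = Sup ?S powr l"
    proof -
      have "0 \<le> Sup ?S" using r A(1) by (intro cSup_upper2[OF imageI[of a] _ disk_bdd[OF v(1)]]) (auto simp: A(5))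
      thus ?thesis by simp
    qed
    finally show ?thesis by (simp add: D)
  qed
  thus ?thesis by (simp add: berk_twist_def disk_point_def l_def)
qed

lemma map_poly_automorphism_mult_add:
  assumes "field_automorphism \<tau>"
  shows "map_poly \<tau> (f * g) = map_poly \<tau> f * map_poly \<tau> g"
    and "map_poly \<tau> (f + g) = map_poly \<tau> f + map_poly \<tau> g"
proof -
  note t = field_automorphismD[OF assms]
  interpret additive \<tau> by unfold_locales (rule t(3))
  show "map_poly \<tau> (f * g) = map_poly \<tau> f * map_poly \<tau> g"
    by (rule poly_eqI) (simp add: coeff_map_poly coeff_mult t sum)
  show "map_poly \<tau> (f + g) = map_poly \<tau> f + map_poly \<tau> g"
    by (rule poly_eqI) (simp add: coeff_map_poly t)
qed

lemma continuous_map_twist_A1: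
  assumes s: "field_automorphism s" and l: "l > 0" "\<And>a. v (s a) powr l = v a"
  shows "continuous_map (berk_A1 v) (berk_A1 v) (\<lambda>\<zeta> f. \<zeta> (map_poly s f) powr l)"
proof -
  note t = field_automorphismD[OF s]
  have "mult_seminorm v (\<lambda>f. \<zeta> (map_poly s f) powr l)" if "mult_seminorm v \<zeta>" for \<zeta>
  proof -
    have z: "\<zeta> f \<ge> 0" "\<zeta> [:a:] = v a" "\<zeta> (f * g) = \<zeta> f * \<zeta> g" "\<zeta> (f + g) \<le> max (\<zeta> f) (\<zeta> g)" for f g a
      using that by (auto simp: mult_seminorm_def)
    have "\<zeta> (f + g) powr l \<le> max (\<zeta> f powr l) (\<zeta> g powr l)" for f g
    proof -
      have mono: "\<zeta> h powr l \<le> \<zeta> h' powr l" if "\<zeta> h \<le> \<zeta> h'" for h h'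
        using l(1) z(1)[of h] that by (intro powr_mono2) auto
      have "\<zeta> (f + g) \<le> \<zeta> f \<or> \<zeta> (f + g) \<le> \<zeta> g" using z(4)[of f g] by (simp add: le_max_iff_disj)
      thus ?thesis using mono by (auto simp: le_max_iff_disj)
    qed
    thus ?thesis
      by (simp add: mult_seminorm_def map_poly_automorphism_mult_add[OF s] z powr_mult
            map_poly_pCons t l(2))
  qed
  moreover have "continuous_map (berk_A1 v) (powertop_real UNIV) (\<lambda>\<zeta> f. \<zeta> (map_poly s f) powr l)"
    unfolding continuous_map_componentwise_UNIV
  proof
    fix f
    have 1: "continuous_map (berk_A1 v) euclideanreal (\<lambda>\<zeta>. \<zeta> (map_poly s f))"
      unfolding berk_A1_def
      by (intro continuous_map_from_subtopology continuous_map_product_projection) auto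
    have 2: "continuous_map euclideanreal euclideanreal (\<lambda>x::real. max 0 x powr l)"
    proof -
      have "continuous_on UNIV (\<lambda>x::real. max 0 x powr l)"
        by (rule continuous_on_powr') (use l(1) in \<open>auto intro: continuous_intros\<close>)
      thus ?thesis by simp
    qed
    have "continuous_map (berk_A1 v) euclideanreal (\<lambda>\<zeta>. max 0 (\<zeta> (map_poly s f)) powr l)"
      using continuous_map_compose[OF 1 2] by (simp add: o_def)
    thus "continuous_map (berk_A1 v) euclideanreal (\<lambda>\<zeta>. \<zeta> (map_poly s f) powr l)"
      by (rule continuous_map_eq) (auto simp: topspace_berk_A1 mult_seminorm_def)
  qed
  ultimately show ?thesis
    unfolding berk_A1_def by (auto simp: continuous_map_in_subtopology)
qed

lemma homeomorphic_map_Alexandroff: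
  assumes "homeomorphic_map X Y h"
  shows "homeomorphic_map (Alexandroff_compactification X) (Alexandroff_compactification Y)
           (map_option h)"
proof -
  have op: "open_map (Alexandroff_compactification X) (Alexandroff_compactification Y) (map_option h)"
    if h: "homeomorphic_map X Y h" for X :: "'x topology" and Y :: "'y topology" and h
    unfolding open_map_def
  proof (intro allI impI)
    fix W assume "openin (Alexandroff_compactification X) W"
    then consider U where "openin X U" "W = Some ` U"
      | C where "compactin X C" "closedin X C" "W = insert None (Some ` (topspace X - C))"
      by (auto simp: openin_Alexandroff_compactification)
    thus "openin (Alexandroff_compactification Y) (map_option h ` W)"
    proof cases
      case 1
      have "openin Y (h ` U)"
        using 1(1) h homeomorphic_map_openness openin_subset by blast
      moreover have "map_option h ` W = Some ` h ` U" using 1(2) by (simp add: image_image)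
      ultimately show ?thesis by simp
    next
      case 2
      have sub: "C \<subseteq> topspace X" using 2(2) by (rule closedin_subset)
      have "compactin Y (h ` C)" "closedin Y (h ` C)"
        using 2(1,2) h sub homeomorphic_map_compactness homeomorphic_map_closedness by blast+
      moreover have "h ` (topspace X - C) = topspace Y - h ` C"
        using inj_on_image_set_diff[OF homeomorphic_imp_injective_map[OF h] _ sub, of "topspace X"]
          homeomorphic_imp_surjective_map[OF h] by simp
      moreover have "map_option h ` W = insert None (Some ` h ` (topspace X - C))"
        using 2(3) by (simp add: image_image)
      ultimately show ?thesis by (auto simp: openin_Alexandroff_compactification)
    qed
  qed
  obtain g where g: "homeomorphic_maps X Y h g" using assms homeomorphic_map_maps by blast
  hence hg: "homeomorphic_map Y X g" using homeomorphic_maps_map by blast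
  let ?A = "Alexandroff_compactification X" and ?B = "Alexandroff_compactification Y"
  have inv: "\<And>x. x \<in> topspace ?A \<Longrightarrow> map_option g (map_option h x) = x"
            "\<And>y. y \<in> topspace ?B \<Longrightarrow> map_option h (map_option g y) = y"
    using g by (auto simp: homeomorphic_maps_def)
  have im: "map_option h ` topspace ?A \<subseteq> topspace ?B" "map_option g ` topspace ?B \<subseteq> topspace ?A"
    using homeomorphic_imp_surjective_map[OF assms] homeomorphic_imp_surjective_map[OF hg] by auto
  have "continuous_map ?A ?B (map_option h)"
    unfolding continuous_map_def
  proof (intro conjI allI impI)
    fix U assume U: "openin ?B U"
    have "{x \<in> topspace ?A. map_option h x \<in> U} = map_option g ` U"
    proof (intro equalityI subsetI)
      fix x assume "x \<in> {x \<in> topspace ?A. map_option h x \<in> U}"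
      thus "x \<in> map_option g ` U" using inv(1) by (metis (mono_tags, lifting) imageI mem_Collect_eq)
    next
      fix x assume "x \<in> map_option g ` U"
      then obtain u where u: "u \<in> U" "x = map_option g u" by auto
      hence "u \<in> topspace ?B" using openin_subset[OF U] by blast
      thus "x \<in> {x \<in> topspace ?A. map_option h x \<in> U}"
        using u inv(2) im(2) by (metis (mono_tags, lifting) imageI mem_Collect_eq subsetD)
    qed
    thus "openin ?A {x \<in> topspace ?A. map_option h x \<in> U}"
      using op[OF hg] U by (simp add: open_map_def)
  qed (use im(1) in blast)
  moreover have "inj_on (map_option h) (topspace ?A)" using inv(1) by (rule inj_on_inverseI)
  moreover have "map_option h ` topspace ?A = topspace ?B"
  proof
    show "topspace ?B \<subseteq> map_option h ` topspace ?A"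
      using im(2) inv(2) by (metis imageI image_subset_iff subsetI)
  qed (rule im(1))
  ultimately show ?thesis
    using op[OF assms] by (intro bijective_open_imp_homeomorphic_map) auto
qed

lemma homeomorphic_map_berk_twist:
  assumes v: "nonarch_abs v" "nontrivial_abs v" and \<tau>: "\<tau> \<in> Aut_star v"
  shows "homeomorphic_map (berk_P1 v) (berk_P1 v) (berk_twist v \<tau>)"
proof -
  note A = nonarch_absD[OF v(1)]
  have aut: "field_automorphism \<tau>" using \<tau> by (simp add: Aut_star_def)
  note t = field_automorphismD[OF aut]
  note i = field_automorphismD[OF field_automorphism_inv[OF aut]]
  define l where "l = twist_exp v \<tau>"
  have l: "l > 0" "\<And>x. v (\<tau> x) = v x powr l" using twist_exp[OF v \<tau>] by (auto simp: l_def)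
  have ti: "\<tau> (inv \<tau> x) = x" "inv \<tau> (\<tau> x) = x" for x
    using t(1) by (simp_all add: bij_is_surj surj_f_inv_f bij_is_inj)
  have "v (\<tau> a) powr (1 / l) = v a" for a
    using l(1) A(1)[of a] by (simp add: l(2) powr_powr)
  with l(1) have 2: "continuous_map (berk_A1 v) (berk_A1 v) (\<lambda>\<zeta> f. \<zeta> (map_poly \<tau> f) powr (1 / l))"
    by (intro continuous_map_twist_A1 aut) auto
  have 1: "continuous_map (berk_A1 v) (berk_A1 v) (\<lambda>\<zeta> f. \<zeta> (map_poly (inv \<tau>) f) powr l)"
    using l(1) by (intro continuous_map_twist_A1 field_automorphism_inv aut)
      (auto simp: ti simp flip: l(2))
  have m: "map_poly \<tau> (map_poly (inv \<tau>) f) = f" "map_poly (inv \<tau>) (map_poly \<tau> f) = f" for f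
    by (rule poly_eqI, simp add: coeff_map_poly t i ti)+
  have "homeomorphic_maps (berk_A1 v) (berk_A1 v)
          (\<lambda>\<zeta> f. \<zeta> (map_poly (inv \<tau>) f) powr l) (\<lambda>\<zeta> f. \<zeta> (map_poly \<tau> f) powr (1 / l))"
    using 1 2 l(1)
    by (auto simp: homeomorphic_maps_def m powr_powr topspace_berk_A1 mult_seminorm_def)
  hence "homeomorphic_map (berk_A1 v) (berk_A1 v) (\<lambda>\<zeta> f. \<zeta> (map_poly (inv \<tau>) f) powr l)"
    by (rule homeomorphic_maps_imp_map)
  thus ?thesis
    unfolding berk_P1_def berk_twist_def l_def by (rule homeomorphic_map_Alexandroff)
qed

end

theory Submission
  imports Defs
begin

text \<open>
  Write \<open>F\<close> for the twisted map. Rational maps act continuously on the compact Hausdorff Berkovich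
  line, and classical points are dense in it.

  Let the iterates be equicontinuous at \<open>x\<close>, so that \<open>F\<^sup>n\<close> maps the classical points of a small
  Berkovich neighbourhood \<open>B\<close> of \<open>x\<close> to spherical distance less than \<open>1/2\<close> from \<open>F\<^sup>n(x)\<close>. If a point of
  \<open>B\<close> were mapped to the Gauss point of some radius \<open>r\<close> with \<open>1/2 < r < 1\<close>, then nearby classical points
  would be mapped to distance at least \<open>1/2\<close>; so the orbit of \<open>B\<close> omits all these Gauss points.

  Conversely, let the orbit of a neighbourhood of \<open>x\<close> omit two finite points \<open>\<zeta> \<noteq> \<eta>\<close>, possibly not
  classical. For a compact disk \<open>D\<close> around \<open>x\<close> each image \<open>F\<^sup>n(D)\<close> is closed, so it also omits
  classical points \<open>b\<^sub>n\<close> near \<open>\<zeta>\<close> and \<open>c\<^sub>n\<close> near \<open>\<eta>\<close>, whose distance is bounded below independently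
  of \<open>n\<close>. Writing \<open>F\<^sup>n = [P : Q] \<circ> \<tau>\<^sup>n\<close> with polynomials \<open>P, Q\<close>, the zero-free polynomials
  \<open>P - b\<^sub>n Q\<close> and \<open>P - c\<^sub>n Q\<close> show that \<open>[P : Q]\<close> is Lipschitz on \<open>\<tau>\<^sup>n(D)\<close> with constant proportional to
  the inverse of the radius \<open>r powr \<lambda>\<^sup>n\<close>. Since \<open>\<tau>\<^sup>n\<close> raises relative distances \<open>|t - t'| / r \<le> 1\<close>
  to the power \<open>\<lambda>\<^sup>n \<ge> 1\<close>, the iterates are uniformly Lipschitz near \<open>x\<close>.
\<close>

section \<open>Seminorms and approximation by classical points\<close>

text \<open>Every polynomial over an algebraically closed field splits, so statements about
  multiplicative seminorms reduce to constants and linear factors.\<close>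

lemma poly_linear_factor_induct [case_names const linear]:
  fixes f :: "'a::alg_closed_field poly"
  assumes const: "\<And>c. P [:c:]" and linear: "\<And>a f. f \<noteq> 0 \<Longrightarrow> P f \<Longrightarrow> P ([:- a, 1:] * f)"
  shows "P f"
proof (induction "degree f" arbitrary: f)
  case 0
  thus ?case using const by (metis degree_eq_zeroE)
next
  case (Suc n)
  then obtain a where "poly f a = 0" using alg_closed_imp_poly_has_root[of f] by auto
  then obtain g where g: "f = [:- a, 1:] * g" by (metis dvdE poly_eq_0_iff_dvd)
  have "g \<noteq> 0" using Suc(2) g by auto
  hence "degree f = Suc (degree g)" by (simp add: g degree_mult_eq del: mult_pCons_left)
  thus ?case using linear[OF \<open>g \<noteq> 0\<close>] Suc g by simp
qed

lemma mult_seminormD: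
  assumes v: "nonarch_abs v" and \<zeta>: "mult_seminorm v \<zeta>"
  shows "\<zeta> f \<ge> 0" "\<zeta> [:a:] = v a" "\<zeta> (f * g) = \<zeta> f * \<zeta> g" "\<zeta> (f + g) \<le> max (\<zeta> f) (\<zeta> g)"
    "\<zeta> 0 = 0" "\<zeta> 1 = 1" "\<zeta> (f ^ n) = \<zeta> f ^ n" "\<zeta> (smult a f) = v a * \<zeta> f" "\<zeta> (- f) = \<zeta> f"
    "\<zeta> f < \<zeta> g \<Longrightarrow> \<zeta> (f + g) = \<zeta> g" "\<zeta> (f - g) = \<zeta> (g - f)"
proof -
  note A = nonarch_absD[OF v]
  show nn: "\<zeta> f \<ge> 0" and c: "\<zeta> [:a:] = v a" and m: "\<zeta> (f * g) = \<zeta> f * \<zeta> g"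
    and add: "\<zeta> (f + g) \<le> max (\<zeta> f) (\<zeta> g)" for f g a
    using \<zeta> by (auto simp: mult_seminorm_def)
  show "\<zeta> 0 = 0" using c[of 0] A(5) by simp
  show one: "\<zeta> 1 = 1" using c[of 1] A(6) by (simp add: one_pCons)
  show "\<zeta> (f ^ n) = \<zeta> f ^ n" by (induction n) (simp_all add: one m)
  show sm: "\<zeta> (smult a f) = v a * \<zeta> f" for a f using m[of "[:a:]" f] by (simp add: c)
  show neg: "\<zeta> (- f) = \<zeta> f" for f using sm[of "-1" f] by (simp add: A(6,7))
  show "\<zeta> (f - g) = \<zeta> (g - f)" using neg[of "f - g"] by simp
  show "\<zeta> (f + g) = \<zeta> g" if "\<zeta> f < \<zeta> g"
    using add[of "f + g" "- f"] add[of f g] neg[of f] that by (simp add: max_def split: if_splits)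
qed

text \<open>Multiplicativity kills every multiple of z - c, in particular f - f(c), so \<zeta> sees
  only the constant f(c). This recognises classical points among seminorms.\<close>

lemma mult_seminorm_linear_zero:
  assumes v: "nonarch_abs v" and \<zeta>: "mult_seminorm v \<zeta>" and 0: "\<zeta> [:- c, 1:] = 0"
  shows "\<zeta> = (\<lambda>f. v (poly f c))"
proof
  fix f
  note Z = mult_seminormD[OF v \<zeta>]
  have "[:- c, 1:] dvd f - [:poly f c:]" by (simp add: poly_eq_0_iff_dvd[symmetric])
  then obtain g where g: "f - [:poly f c:] = [:- c, 1:] * g" by (elim dvdE)
  have d: "\<zeta> (f - [:poly f c:]) = 0" unfolding g Z(3) by (simp add: 0)
  have "\<zeta> f \<le> v (poly f c)" "v (poly f c) \<le> \<zeta> f"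
    using Z(4)[of "f - [:poly f c:]" "[:poly f c:]"] Z(4)[of "[:poly f c:] - f" f] d Z(11)[of f] Z(1)[of f]
      Z(1)[of "[:poly f c:]"]
    by (simp_all add: Z(2))
  thus "\<zeta> f = v (poly f c)" by simp
qed

section \<open>The value group and approximation by generic points\<close>

locale nonarch_field =
  fixes v :: "'a::{alg_closed_field, field_char_0} \<Rightarrow> real"
  assumes nonarch: "nonarch_abs v" and nontrivial: "nontrivial_abs v"
begin

lemmas v_simps = nonarch_absD[OF nonarch]

lemma v_add_eq: "v x < v y \<Longrightarrow> v (x + y) = v y"
  using v_simps(4)[of "x + y" "- x"] v_simps(4)[of x y] v_simps(7)[of x]
  by (simp add: max_def split: if_splits)

lemma v_add_neq: "v x \<noteq> v y \<Longrightarrow> v (x + y) = max (v x) (v y)"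
  using v_add_eq[of x y] v_add_eq[of y x] by (cases "v x < v y") (auto simp: add.commute)

lemma v_diff_le: "v (x - y) \<le> max (v x) (v y)"
  using v_simps(4)[of x "- y"] by (simp add: v_simps)

lemma v_divide: "v (x / y) = v x / v y"
proof (cases "y = 0")
  case False
  have "v (x / y) * v y = v x" using False by (simp add: v_simps(3)[symmetric])
  thus ?thesis using False v_simps(2)[of y] by (simp add: field_simps)
qed (simp add: v_simps)

text \<open>Roots exist, so the value group is divisible; being nontrivial, it is dense in the
  positive reals.\<close>

lemma ex_abs_between:
  assumes "0 \<le> \<rho>" "\<rho> < \<sigma>"
  shows "\<exists>x. \<rho> < v x \<and> v x < \<sigma>"
proof -
  obtain c where c: "c \<noteq> 0" "v c \<noteq> 1" using nontrivial by (auto simp: nontrivial_abs_def)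
  have "v c > 0" using c v_simps(1,2)[of c] by linarith
  have "\<exists>b. v b > 1"
  proof (cases "v c > 1")
    case False
    hence "v (1 / c) > 1" using c \<open>v c > 0\<close> by (simp add: v_divide v_simps)
    thus ?thesis by blast
  qed blast
  then obtain b where b: "v b > 1" by blast
  \<comment> \<open>The midpoint is positive even for \<open>\<rho> = 0\<close>, so logarithms can
    be used.\<close>
  define \<rho>' where "\<rho>' = (\<rho> + \<sigma>) / 2"
  have r: "\<rho> < \<rho>'" "\<rho>' < \<sigma>" "\<rho>' > 0" using assms by (auto simp: \<rho>'_def field_simps)
  define L where "L = ln (\<sigma> / \<rho>')"
  have L: "L > 0" using r by (simp add: L_def)
  \<comment> \<open>An n-th root \<open>d\<close> of \<open>b\<close> then has
    \<open>0 < ln (v d) < L\<close>: its powers advance by steps shorter than the logarithmic length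
    of the target interval.\<close>
  obtain n :: nat where n: "real n * L > ln (v b)" using reals_Archimedean3[OF L] by blast
  have ln0: "ln (v b) > 0" using b by simp
  have n0: "n > 0" using n ln0 by (cases n) auto
  obtain d where d: "d ^ n = b" using nth_root_exists[OF n0] by blast
  have vd: "v d ^ n = v b" using d v_simps(9)[of d n] by simp
  have d1: "v d > 1" using vd b n0 power_le_one[of "v d" n] v_simps(1)[of d] by (metis not_le)
  have "real n * ln (v d) = ln (v b)" using vd d1 by (metis ln_realpow order_less_trans zero_less_one)
  hence "real n * ln (v d) < real n * L" using n by simp
  hence "ln (v d) < L" using n0 by simp
  \<comment> \<open>\<open>k + 1\<close> is the least exponent taking \<open>v d\<close> beyond
    \<open>\<rho>'\<close>; the overshoot is at most one factor
    \<open>v d < \<sigma> / \<rho>'\<close>.\<close>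
  define k where "k = floor (ln \<rho>' / ln (v d))"
  define x where "x = d powi (k + 1)"
  have lnd: "ln (v d) > 0" using d1 by simp
  have vpow: "v (d powi m) = v d powi m" for m
  proof (cases "m \<ge> 0")
    case True thus ?thesis by (simp add: power_int_def v_simps)
  next
    case False
    thus ?thesis using v_divide[of 1 "d ^ nat (- m)"]
      by (simp add: power_int_def v_simps divide_inverse power_inverse)
  qed
  have vx0: "v x > 0" using d1 by (simp add: x_def vpow)
  have lnx: "ln (v x) = real_of_int (k + 1) * ln (v d)"
  proof -
    have "v x = v d powr real_of_int (k + 1)" unfolding x_def vpow using d1 powr_real_of_int'[of "v d" "k + 1"] by simp
    thus ?thesis using d1 by (simp add: ln_powr)
  qed
  have k: "real_of_int k \<le> ln \<rho>' / ln (v d)" "ln \<rho>' / ln (v d) < real_of_int k + 1"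
    unfolding k_def by linarith+
  have "ln \<rho>' < ln (v x)" using k(2) lnd by (simp add: lnx field_simps)
  hence 1: "\<rho>' < v x" using r vx0 by simp
  have "ln (v x) \<le> ln \<rho>' + ln (v d)" using k(1) lnd by (simp add: lnx field_simps)
  also have "\<dots> < ln \<sigma>" using \<open>ln (v d) < L\<close> r by (simp add: L_def ln_div)
  finally have "v x < \<sigma>" using r vx0 by simp
  thus ?thesis using 1 r by force
qed

lemma ex_seq_abs_tendsto:
  assumes "0 \<le> \<rho>"
  shows "\<exists>t. (\<forall>k. v (t k) > \<rho>) \<and> (\<lambda>k. v (t k)) \<longlonglongrightarrow> \<rho>"
proof -
  have "\<exists>x. \<rho> < v x \<and> v x < \<rho> + inverse (real (Suc k))" for k
    by (rule ex_abs_between) (use assms in auto)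
  then obtain t where t: "\<And>k. \<rho> < v (t k)" "\<And>k. v (t k) < \<rho> + inverse (real (Suc k))" by metis
  have "(\<lambda>k. v (t k)) \<longlonglongrightarrow> \<rho>"
  proof (rule tendsto_sandwich[OF _ _ tendsto_const])
    show "(\<lambda>k. \<rho> + inverse (real (Suc k))) \<longlonglongrightarrow> \<rho>"
      using tendsto_add[OF tendsto_const LIMSEQ_inverse_real_of_nat] by simp
  qed (use t in \<open>auto intro!: always_eventually less_imp_le\<close>)
  thus ?thesis using t(1) by blast
qed

text \<open>Because \<open>v (t k)\<close> tends to \<rho> strictly from above, it eventually
  differs from \<open>v b\<close>: it is smaller if \<open>v b > \<rho>\<close> and larger
  otherwise. The ultrametric inequality is then an equality.\<close>

lemma generic_seq_tendsto:
  assumes t: "\<And>k. v (t k) > \<rho>" "(\<lambda>k. v (t k)) \<longlonglongrightarrow> \<rho>"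
  shows "(\<lambda>k. v (t k + b)) \<longlonglongrightarrow> max \<rho> (v b)"
proof -
  have "eventually (\<lambda>k. v (t k) \<noteq> v b) sequentially"
  proof (cases "v b > \<rho>")
    case True
    from order_tendstoD(2)[OF t(2) True] show ?thesis by eventually_elim simp
  next
    case False
    thus ?thesis using t(1) by (intro always_eventually allI) (metis not_le order_less_le_trans less_irrefl)
  qed
  hence "eventually (\<lambda>k. max (v (t k)) (v b) = v (t k + b)) sequentially"
    by eventually_elim (simp add: v_add_neq)
  moreover have "(\<lambda>k. max (v (t k)) (v b)) \<longlonglongrightarrow> max \<rho> (v b)" by (intro tendsto_intros t)
  ultimately show ?thesis by (rule Lim_transform_eventually[rotated])
qed

text \<open>If \<open>a\<close> is the point of a finite set \<open>A\<close> closest to \<open>\<zeta>\<close>, then a generic point on a circle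
  around \<open>a\<close> of radius slightly larger than \<open>\<zeta> (z - a)\<close> approximates \<open>\<zeta>\<close> on all of \<open>A\<close>.\<close>

lemma seminorm_approx_linear:
  assumes \<zeta>: "mult_seminorm v \<zeta>" and A: "finite A"
  shows "\<exists>y. \<forall>a\<in>A. (\<lambda>k. v (y k - a)) \<longlonglongrightarrow> \<zeta> [:- a, 1:]"
proof (cases "A = {}")
  case False
  note Z = mult_seminormD[OF nonarch \<zeta>]
  obtain a where a: "a \<in> A" "\<And>b. b \<in> A \<Longrightarrow> \<zeta> [:- a, 1:] \<le> \<zeta> [:- b, 1:]"
    using A False arg_min_if_finite[of A "\<lambda>a. \<zeta> [:- a, 1:]"] by (metis linorder_not_less)
  define \<rho> where "\<rho> = \<zeta> [:- a, 1:]"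
  obtain t where t: "\<And>k. v (t k) > \<rho>" "(\<lambda>k. v (t k)) \<longlonglongrightarrow> \<rho>"
    using ex_seq_abs_tendsto[of \<rho>] Z(1) by (auto simp: \<rho>_def)
  have "(\<lambda>k. v ((t k + a) - b)) \<longlonglongrightarrow> \<zeta> [:- b, 1:]" if b: "b \<in> A" for b
  proof -
    have e: "[:- b, 1:] = [:a - b:] + [:- a, 1:]" "[:- b, 1:] = [:- a, 1:] + [:a - b:]" by auto
    have "max \<rho> (v (a - b)) = \<zeta> [:- b, 1:]"
    proof (rule antisym)
      show "\<zeta> [:- b, 1:] \<le> max \<rho> (v (a - b))"
        unfolding e \<rho>_def using Z(4)[of "[:- a, 1:]" "[:a - b:]"] by (simp add: Z(2))
      \<comment> \<open>If \<open>v (a - b) > \<rho>\<close>, the strict ultrametric rule gives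
        equality with \<open>v (a - b)\<close>; otherwise the maximum is \<rho>, and minimality of
        \<open>a\<close> applies.\<close>
      show "max \<rho> (v (a - b)) \<le> \<zeta> [:- b, 1:]"
        using Z(10)[of "[:- a, 1:]" "[:a - b:]"] a(2)[OF b] unfolding e(2)[symmetric] \<rho>_def Z(2)
        by linarith
    qed
    thus ?thesis using generic_seq_tendsto[OF t, of "a - b"] by (simp add: algebra_simps)
  qed
  thus ?thesis by (intro exI[of _ "\<lambda>k. t k + a"]) blast
qed auto

text \<open>Convergence on the linear factors multiplies up to f. The zero polynomial is allowed
  separately because its roots cannot lie in a finite set.\<close>

lemma seminorm_approx_poly:
  assumes \<zeta>: "mult_seminorm v \<zeta>" and A: "finite A" "\<forall>a\<in>A. (\<lambda>k. v (y k - a)) \<longlonglongrightarrow> \<zeta> [:- a, 1:]"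
  shows "f = 0 \<or> {x. poly f x = 0} \<subseteq> A \<Longrightarrow> (\<lambda>k. v (poly f (y k))) \<longlonglongrightarrow> \<zeta> f"
proof (induction f rule: poly_linear_factor_induct)
  case (const c)
  show ?case by (simp add: mult_seminormD(2)[OF nonarch \<zeta>])
next
  case (linear a f)
  have r: "poly ([:- a, 1:] * f) x = (x - a) * poly f x" for x by (simp add: algebra_simps)
  have "[:- a, 1:] * f \<noteq> 0" using linear(1) by (metis mult_eq_0_iff pCons_eq_0_iff zero_neq_one)
  hence "{x. poly ([:- a, 1:] * f) x = 0} \<subseteq> A" using linear(3) by blast
  hence "a \<in> A" and sub: "{x. poly f x = 0} \<subseteq> A" unfolding r by auto
  have "(\<lambda>k. v (y k - a) * v (poly f (y k))) \<longlonglongrightarrow> \<zeta> [:- a, 1:] * \<zeta> f"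
    using A(2) \<open>a \<in> A\<close> linear.IH sub by (intro tendsto_mult) auto
  moreover have "v (poly ([:- a, 1:] * f) (y k)) = v (y k - a) * v (poly f (y k))" for k
    by (simp only: poly_mult v_simps(3)) simp
  ultimately show ?case unfolding mult_seminormD(3)[OF nonarch \<zeta>] by simp
qed

lemma seminorm_approx:
  assumes \<zeta>: "mult_seminorm v \<zeta>" and I: "finite I"
  shows "\<exists>y. \<forall>f\<in>I. (\<lambda>k. v (poly f (y k))) \<longlonglongrightarrow> \<zeta> f"
proof -
  define A where "A = (\<Union>f\<in>I - {0}. {x. poly f x = 0})"
  have A: "finite A" using I poly_roots_finite by (auto simp: A_def)
  obtain y where "\<forall>a\<in>A. (\<lambda>k. v (y k - a)) \<longlonglongrightarrow> \<zeta> [:- a, 1:]"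
    using seminorm_approx_linear[OF \<zeta> A] by blast
  hence "(\<lambda>k. v (poly f (y k))) \<longlonglongrightarrow> \<zeta> f" if "f \<in> I" for f
    using that by (intro seminorm_approx_poly[OF \<zeta> A]) (auto simp: A_def)
  thus ?thesis by blast
qed

text \<open>The Gauss point of radius \<open>r\<close>, as a limit of generic points on shrinking circles.\<close>

lemma ex_gauss_seminorm:
  assumes r: "r \<ge> 0"
  shows "\<exists>\<eta>. mult_seminorm v \<eta> \<and> (\<forall>a. \<eta> [:- a, 1:] = max r (v a))"
proof -
  obtain t where t: "\<And>k. v (t k) > r" "(\<lambda>k. v (t k)) \<longlonglongrightarrow> r"
    using ex_seq_abs_tendsto[OF r] by blast
  have lin: "(\<lambda>k. v (t k - a)) \<longlonglongrightarrow> max r (v a)" for a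
    using generic_seq_tendsto[OF t, of "- a"] by (simp add: v_simps)
  have conv: "convergent (\<lambda>k. v (poly f (t k)))" for f
  proof (induction f rule: poly_linear_factor_induct)
    case (linear a f)
    have "convergent (\<lambda>k. v (t k - a) * v (poly f (t k)))"
      by (intro convergent_mult linear) (use lin in \<open>auto simp: convergent_def\<close>)
    moreover have "v (poly ([:- a, 1:] * f) (t k)) = v (t k - a) * v (poly f (t k))" for k
      by (simp only: poly_mult v_simps(3)) simp
    ultimately show ?case by simp
  qed (simp add: convergent_const)
  define \<eta> where "\<eta> f = lim (\<lambda>k. v (poly f (t k)))" for f
  have lim: "(\<lambda>k. v (poly f (t k))) \<longlonglongrightarrow> \<eta> f" for f
    using conv[of f] by (simp add: \<eta>_def convergent_LIMSEQ_iff)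
  have "mult_seminorm v \<eta>" unfolding mult_seminorm_def
  proof (intro conjI allI)
    show "\<eta> f \<ge> 0" for f by (rule LIMSEQ_le_const[OF lim]) (simp add: v_simps)
    show "\<eta> [:a:] = v a" for a by (rule LIMSEQ_unique[OF lim]) simp
    show "\<eta> (f * g) = \<eta> f * \<eta> g" for f g
      by (rule LIMSEQ_unique[OF lim]) (simp add: v_simps(3) tendsto_mult lim)
    show "\<eta> (f + g) \<le> max (\<eta> f) (\<eta> g)" for f g
      by (rule LIMSEQ_le[OF lim tendsto_max[OF lim lim]]) (simp add: v_simps(4))
  qed
  moreover have "\<eta> [:- a, 1:] = max r (v a)" for a
    by (rule LIMSEQ_unique[OF lim]) (use lin[of a] in simp)
  ultimately show ?thesis by blast
qed

end

section \<open>Topology of the Berkovich line\<close>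

text \<open>Passes to the type class topology on functions, where \<open>compact\<close>,
  \<open>open\<close> and \<open>continuous_on\<close> are available.\<close>

lemma berk_A1_eq_top_of_set: "berk_A1 v = top_of_set {\<zeta>. mult_seminorm v \<zeta>}"
  by (simp add: berk_A1_def euclidean_product_topology)

lemma openin_berk_A1_iff:
  "openin (berk_A1 v) U \<longleftrightarrow> (\<exists>T. open T \<and> U = {\<zeta>. mult_seminorm v \<zeta>} \<inter> T)"
  by (simp add: berk_A1_eq_top_of_set openin_open)

lemma continuous_on_seminorm_eval: "continuous_on S (\<lambda>\<zeta>. \<zeta> f :: real)"
  using continuous_on_product_coordinates by (rule continuous_on_subset) simp

lemma closed_mult_seminorm: "closed {\<zeta>. mult_seminorm v \<zeta>}"
  unfolding mult_seminorm_def
  by (intro closed_Collect_conj closed_Collect_all closed_Collect_le closed_Collect_eq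
      continuous_intros continuous_on_seminorm_eval)

lemma compactin_berk_A1_iff: "compactin (berk_A1 v) C \<longleftrightarrow> compact C \<and> C \<subseteq> {\<zeta>. mult_seminorm v \<zeta>}"
  by (auto simp: berk_A1_eq_top_of_set compactin_subtopology)

lemma Hausdorff_berk_A1: "Hausdorff_space (berk_A1 v)"
  unfolding berk_A1_def
  by (rule Hausdorff_space_subtopology) (metis Hausdorff_space_euclidean Hausdorff_space_product_topology)

lemma openin_vimage_Some:
  "openin (berk_P1 v) W \<Longrightarrow> openin (berk_A1 v) {\<zeta>. mult_seminorm v \<zeta> \<and> Some \<zeta> \<in> W}"
  using openin_continuous_map_preimage[OF continuous_map_Some, of "berk_A1 v" W]
  by (simp add: berk_P1_def topspace_berk_A1)

lemma openin_image_Some: "openin (berk_A1 v) U \<Longrightarrow> openin (berk_P1 v) (Some ` U)"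
  by (simp add: berk_P1_def)

section \<open>Compact disks, neighbourhood bases and density of classical points\<close>

context nonarch_field
begin

text \<open>Each factor z - a equals (z - c) + (c - a), hence is bounded on the disk. The bound on
  every coordinate prepares the use of Tychonoff's theorem.\<close>

lemma mult_seminorm_bounded:
  "\<exists>B. \<forall>\<zeta>. mult_seminorm v \<zeta> \<longrightarrow> \<zeta> [:- c, 1:] \<le> r \<longrightarrow> \<zeta> f \<le> B"
proof (induction f rule: poly_linear_factor_induct)
  case (const b)
  show ?case by (intro exI[of _ "v b"]) (simp add: mult_seminorm_def)
next
  case (linear a f)
  then obtain B where B: "\<And>\<zeta>. mult_seminorm v \<zeta> \<Longrightarrow> \<zeta> [:- c, 1:] \<le> r \<Longrightarrow> \<zeta> f \<le> B" by blast
  have "\<zeta> ([:- a, 1:] * f) \<le> max r (v (c - a)) * B"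
    if \<zeta>: "mult_seminorm v \<zeta>" "\<zeta> [:- c, 1:] \<le> r" for \<zeta>
  proof -
    note Z = mult_seminormD[OF nonarch \<zeta>(1)]
    have "\<zeta> [:- a, 1:] \<le> max (\<zeta> [:- c, 1:]) (\<zeta> [:c - a:])"
      using Z(4)[of "[:- c, 1:]" "[:c - a:]"] by simp
    hence "\<zeta> [:- a, 1:] \<le> max r (v (c - a))" using \<zeta>(2) unfolding Z(2) by linarith
    thus ?thesis unfolding Z(3) using B[OF \<zeta>] Z(1) by (intro mult_mono) (auto intro: order_trans)
  qed
  thus ?case by blast
qed

text \<open>The disk is a closed subset of a product of compact intervals, since the seminorm axioms
  are closed under pointwise convergence.\<close>

lemma compact_berk_disk: "compact {\<zeta>. mult_seminorm v \<zeta> \<and> \<zeta> [:- c, 1:] \<le> r}"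
proof -
  obtain B where B: "\<And>\<zeta> f. mult_seminorm v \<zeta> \<Longrightarrow> \<zeta> [:- c, 1:] \<le> r \<Longrightarrow> \<zeta> f \<le> B f"
    using mult_seminorm_bounded[of c r] by metis
  have "compactin (powertop_real UNIV) (\<Pi>\<^sub>E f\<in>UNIV. {0..B f})" by (simp add: compactin_PiE)
  hence "compact (\<Pi>\<^sub>E f\<in>UNIV. {0..B f})" by (simp add: euclidean_product_topology)
  moreover have "closed {\<zeta>. mult_seminorm v \<zeta> \<and> \<zeta> [:- c, 1:] \<le> r}"
    by (intro closed_Collect_conj closed_mult_seminorm closed_Collect_le continuous_intros
        continuous_on_seminorm_eval)
  moreover have "{\<zeta>. mult_seminorm v \<zeta> \<and> \<zeta> [:- c, 1:] \<le> r} \<subseteq> (\<Pi>\<^sub>E f\<in>UNIV. {0..B f})"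
    using B mult_seminormD(1)[OF nonarch] by auto
  ultimately show ?thesis using compact_Int_closed inf.absorb2 by fastforce
qed

lemma openin_berk_A1_less: "openin (berk_A1 v) {\<zeta>. mult_seminorm v \<zeta> \<and> \<zeta> f < r}"
proof -
  have "open {\<zeta>::'a poly \<Rightarrow> real. \<zeta> f < r}"
    by (intro open_Collect_less continuous_intros continuous_on_seminorm_eval)
  thus ?thesis unfolding openin_berk_A1_iff by blast
qed

lemma openin_berk_A1_greater: "openin (berk_A1 v) {\<zeta>. mult_seminorm v \<zeta> \<and> \<zeta> f > r}"
proof -
  have "open {\<zeta>::'a poly \<Rightarrow> real. \<zeta> f > r}"
    by (intro open_Collect_less continuous_intros continuous_on_seminorm_eval)
  thus ?thesis unfolding openin_berk_A1_iff by blast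
qed

lemma openin_berk_P1_at_infinity:
  "openin (berk_P1 v) (insert None (Some ` {\<zeta>. mult_seminorm v \<zeta> \<and> \<zeta> [:0, 1:] > R}))"
proof -
  let ?C = "{\<zeta>. mult_seminorm v \<zeta> \<and> \<zeta> [:0, 1:] \<le> R}"
  have "compactin (berk_A1 v) ?C" using compact_berk_disk[of 0 R] by (auto simp: compactin_berk_A1_iff)
  moreover from this have "closedin (berk_A1 v) ?C" by (rule compactin_imp_closedin[OF Hausdorff_berk_A1])
  moreover have "{\<zeta>. mult_seminorm v \<zeta> \<and> \<zeta> [:0, 1:] > R} = topspace (berk_A1 v) - ?C"
    by (auto simp: topspace_berk_A1)
  ultimately show ?thesis unfolding berk_P1_def openin_Alexandroff_compactification by blast
qed

lemma locally_compact_berk_A1: "locally_compact_space (berk_A1 v)"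
  unfolding locally_compact_space_def
proof
  fix \<zeta> assume "\<zeta> \<in> topspace (berk_A1 v)"
  hence \<zeta>: "mult_seminorm v \<zeta>" by (simp add: topspace_berk_A1)
  let ?r = "\<zeta> [:- 0, 1:] + 1"
  show "\<exists>U K. openin (berk_A1 v) U \<and> compactin (berk_A1 v) K \<and> \<zeta> \<in> U \<and> U \<subseteq> K"
  proof (intro exI conjI)
    show "openin (berk_A1 v) {\<zeta>. mult_seminorm v \<zeta> \<and> \<zeta> [:- 0, 1:] < ?r}"
      by (rule openin_berk_A1_less)
    show "compactin (berk_A1 v) {\<zeta>. mult_seminorm v \<zeta> \<and> \<zeta> [:- 0, 1:] \<le> ?r}"
      using compact_berk_disk[of 0 ?r] by (auto simp: compactin_berk_A1_iff)
  qed (use \<zeta> in auto)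
qed

lemma Hausdorff_berk_P1: "Hausdorff_space (berk_P1 v)"
  by (simp add: berk_P1_def Hausdorff_space_Alexandroff_compactification locally_compact_berk_A1
      Hausdorff_berk_A1)

lemma compact_berk_P1: "compact_space (berk_P1 v)"
  by (simp add: berk_P1_def)

text \<open>On the part of the compact unit disk outside the neighbourhood, \<zeta>(z - c) attains a
  minimum. It is positive, because value 0 occurs only at the classical point c itself; half of it
  serves as radius.\<close>

lemma berk_nhd_finite:
  assumes W: "openin (berk_P1 v) W" "typeI v (Some c) \<in> W"
  shows "\<exists>r>0. \<forall>\<zeta>. mult_seminorm v \<zeta> \<longrightarrow> \<zeta> [:- c, 1:] \<le> r \<longrightarrow> Some \<zeta> \<in> W"
proof -
  let ?D = "{\<zeta>. mult_seminorm v \<zeta> \<and> \<zeta> [:- c, 1:] \<le> 1}"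
  obtain T where T: "open T" "{\<zeta>. mult_seminorm v \<zeta> \<and> Some \<zeta> \<in> W} = {\<zeta>. mult_seminorm v \<zeta>} \<inter> T"
    using openin_vimage_Some[OF W(1)] unfolding openin_berk_A1_iff by blast
  have in_W: "Some \<zeta> \<in> W" if "mult_seminorm v \<zeta>" "\<zeta> \<in> T" for \<zeta> using T(2) that by blast
  have K: "compact (?D - T)" by (rule compact_diff[OF compact_berk_disk T(1)])
  show ?thesis
  proof (cases "?D - T = {}")
    case True
    thus ?thesis using in_W by (intro exI[of _ 1]) auto
  next
    case False
    from continuous_attains_inf[OF K False continuous_on_seminorm_eval] obtain \<zeta>0
      where z0: "\<zeta>0 \<in> ?D - T" "\<And>\<zeta>. \<zeta> \<in> ?D - T \<Longrightarrow> \<zeta>0 [:- c, 1:] \<le> \<zeta> [:- c, 1:]" by blast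
    let ?r = "\<zeta>0 [:- c, 1:]"
    have s0: "mult_seminorm v \<zeta>0" using z0(1) by simp
    have "?r \<noteq> 0"
    proof
      assume "?r = 0"
      hence "\<zeta>0 = (\<lambda>f. v (poly f c))" by (rule mult_seminorm_linear_zero[OF nonarch s0])
      hence "Some \<zeta>0 \<in> W" using W(2) by (simp add: typeI_def)
      thus False using z0(1) T(2) s0 by blast
    qed
    hence pos: "?r > 0" using mult_seminormD(1)[OF nonarch s0, of "[:- c, 1:]"] by linarith
    have "Some \<zeta> \<in> W" if \<zeta>: "mult_seminorm v \<zeta>" "\<zeta> [:- c, 1:] \<le> ?r / 2" for \<zeta>
    proof (rule in_W[OF \<zeta>(1)], rule ccontr)
      assume "\<zeta> \<notin> T"
      moreover have "\<zeta> [:- c, 1:] \<le> 1" using \<zeta>(2) z0(1) pos by auto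
      ultimately have "?r \<le> \<zeta> [:- c, 1:]" using z0(2)[of \<zeta>] \<zeta>(1) by blast
      thus False using \<zeta>(2) pos by linarith
    qed
    thus ?thesis using pos by (intro exI[of _ "?r / 2"]) auto
  qed
qed

text \<open>The finite points outside such a neighbourhood form a compact set, on which the
  continuous function \<zeta>(z) is bounded.\<close>

lemma berk_nhd_infinity:
  assumes W: "openin (berk_P1 v) W" "None \<in> W"
  shows "\<exists>R>0. \<forall>\<zeta>. mult_seminorm v \<zeta> \<longrightarrow> \<zeta> [:0, 1:] \<ge> R \<longrightarrow> Some \<zeta> \<in> W"
proof -
  obtain C where C: "compactin (berk_A1 v) C" "W = insert None (Some ` (topspace (berk_A1 v) - C))"
    using W unfolding berk_P1_def openin_Alexandroff_compactification by auto
  have K: "compact C" using C(1) by (simp add: compactin_berk_A1_iff)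
  have "compact ((\<lambda>\<zeta>. \<zeta> [:0, 1:]) ` C)"
    by (rule compact_continuous_image[OF continuous_on_seminorm_eval K])
  then obtain R where "R > 0" "\<And>\<zeta>. \<zeta> \<in> C \<Longrightarrow> \<bar>\<zeta> [:0, 1:]\<bar> \<le> R"
    using compact_imp_bounded[of "(\<lambda>\<zeta>. \<zeta> [:0, 1:]) ` C"] by (auto simp: bounded_pos)
  thus ?thesis using C(2)
  proof (intro exI[of _ "R + 1"] conjI allI impI)
    fix \<zeta> assume \<zeta>: "mult_seminorm v \<zeta>" "R + 1 \<le> \<zeta> [:0, 1:]"
    hence "\<zeta> \<notin> C" using \<open>\<And>\<zeta>. \<zeta> \<in> C \<Longrightarrow> \<bar>\<zeta> [:0, 1:]\<bar> \<le> R\<close>[of \<zeta>] by auto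
    thus "Some \<zeta> \<in> W" using C(2) \<zeta>(1) by (simp add: topspace_berk_A1)
  qed simp
qed

text \<open>A basic open set of the product topology constrains only finitely many polynomials, so
  \<open>seminorm_approx\<close> reaches it.\<close>

lemma typeI_dense_A1:
  assumes U: "openin (berk_A1 v) U" "\<zeta> \<in> U"
  shows "\<exists>x. (\<lambda>f. v (poly f x)) \<in> U"
proof -
  obtain T where T: "open T" "U = {\<zeta>. mult_seminorm v \<zeta>} \<inter> T"
    using U(1) unfolding openin_berk_A1_iff by blast
  have s: "mult_seminorm v \<zeta>" and "\<zeta> \<in> T" using U(2) T(2) by auto
  have "openin (powertop_real UNIV) T" using T(1) by (simp add: euclidean_product_topology)
  from product_topology_open_contains_basis[OF this \<open>\<zeta> \<in> T\<close>] obtain X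
    where X: "\<zeta> \<in> (\<Pi>\<^sub>E f\<in>UNIV. X f)" "\<And>f. open (X f)" "finite {f. X f \<noteq> UNIV}" "(\<Pi>\<^sub>E f\<in>UNIV. X f) \<subseteq> T"
    by auto
  obtain y where y: "\<And>f. X f \<noteq> UNIV \<Longrightarrow> (\<lambda>k. v (poly f (y k))) \<longlonglongrightarrow> \<zeta> f"
    using seminorm_approx[OF s X(3)] by blast
  have "eventually (\<lambda>k. \<forall>f\<in>{f. X f \<noteq> UNIV}. v (poly f (y k)) \<in> X f) sequentially"
    unfolding eventually_ball_finite_distrib[OF X(3)]
  proof
    fix f assume f: "f \<in> {f. X f \<noteq> UNIV}"
    have "\<zeta> f \<in> X f" using X(1) by blast
    thus "eventually (\<lambda>k. v (poly f (y k)) \<in> X f) sequentially"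
      using topological_tendstoD[OF y X(2)] f by blast
  qed
  then obtain k where "\<forall>f\<in>{f. X f \<noteq> UNIV}. v (poly f (y k)) \<in> X f"
    by (auto simp: eventually_sequentially)
  hence "v (poly f (y k)) \<in> X f" for f by (cases "X f = UNIV") auto
  hence "(\<lambda>f. v (poly f (y k))) \<in> T" using X(4) by auto
  thus ?thesis using T(2) mult_seminorm_typeI[OF nonarch, of "y k"] by blast
qed

lemma typeI_dense_P1:
  assumes W: "openin (berk_P1 v) W" "\<zeta> \<in> W"
  shows "\<exists>x. typeI v x \<in> W"
proof (cases \<zeta>)
  case None
  thus ?thesis using W(2) by (intro exI[of _ None]) (simp add: typeI_def)
next
  case (Some \<eta>)
  have "\<zeta> \<in> topspace (berk_P1 v)" using W openin_subset by blast
  hence "\<eta> \<in> {\<zeta>. mult_seminorm v \<zeta> \<and> Some \<zeta> \<in> W}" using Some W(2) by (auto simp: topspace_berk_P1)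
  from typeI_dense_A1[OF openin_vimage_Some[OF W(1)] this] obtain x
    where "Some (\<lambda>f. v (poly f x)) \<in> W" by blast
  thus ?thesis by (intro exI[of _ "Some x"]) (simp add: typeI_def)
qed

end

section \<open>Continuity of rational maps\<close>

lemma lowest_terms_no_common_zero: "poly (rat_num \<phi>) a \<noteq> 0 \<or> poly (rat_den \<phi>) a \<noteq> 0"
proof (rule ccontr)
  assume "\<not> ?thesis"
  hence "[:- a, 1:] dvd rat_num \<phi>" "[:- a, 1:] dvd rat_den \<phi>" by (simp_all add: poly_eq_0_iff_dvd)
  hence "is_unit [:- a, 1:]" using lowest_terms(2)[of \<phi>] coprime_common_divisor by blast
  thus False by (simp add: is_unit_iff_degree)
qed

text \<open>\<open>poly_subst_num\<close> describes \<open>subst_num\<close> only where q does not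
  vanish; multiplying by q removes the exceptional points.\<close>

lemma poly_eq_off_zeros:
  fixes f g q :: "'a::{field_char_0} poly"
  assumes "q \<noteq> 0" "\<And>x. poly q x \<noteq> 0 \<Longrightarrow> poly f x = poly g x"
  shows "f = g"
proof -
  have "poly (q * f) = poly (q * g)" using assms(2) by (force simp: fun_eq_iff)
  hence "q * f = q * g" by (simp only: poly_eq_poly_eq_iff)
  thus ?thesis using assms(1) by simp
qed

lemma subst_num_mult:
  fixes p q :: "'a::{field_char_0} poly"
  assumes "q \<noteq> 0" "f \<noteq> 0" "g \<noteq> 0"
  shows "subst_num p q (f * g) = subst_num p q f * subst_num p q g"
  by (rule poly_eq_off_zeros[OF assms(1)])
    (simp add: poly_subst_num degree_mult_eq assms power_add)

text \<open>The three numerators belong to different powers of q, and the degree of a sum may drop.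
  Padding brings all of them over the common denominator \<open>q ^ N\<close>.\<close>

lemma subst_num_add:
  fixes p q :: "'a::{field_char_0} poly"
  assumes q: "q \<noteq> 0" and N: "degree f \<le> N" "degree g \<le> N"
  shows "q ^ (N - degree (f + g)) * subst_num p q (f + g) =
         q ^ (N - degree f) * subst_num p q f + q ^ (N - degree g) * subst_num p q g"
proof (rule poly_eq_off_zeros[OF q])
  fix x assume x: "poly q x \<noteq> 0"
  have pad: "poly q x ^ (N - degree h) * (c * poly q x ^ degree h) = c * poly q x ^ N"
    if "degree h \<le> N" for h and c
    using that by (simp add: mult.left_commute flip: power_add)
  have fg: "degree (f + g) \<le> N" using N by (rule degree_add_le)
  thus "poly (q ^ (N - degree (f + g)) * subst_num p q (f + g)) x =
        poly (q ^ (N - degree f) * subst_num p q f + q ^ (N - degree g) * subst_num p q g) x"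
    by (simp only: poly_mult poly_add[of _ _ x] poly_power poly_subst_num[OF x] pad[OF N(1)]
        pad[OF N(2)] pad[OF fg]) (simp add: distrib_right)
qed

lemma continuous_map_iterate:
  assumes "continuous_map X X f"
  shows "continuous_map X X (f ^^ n)"
proof (induction n)
  case (Suc n)
  show ?case unfolding funpow.simps by (rule continuous_map_compose[OF Suc assms])
qed simp

lemma subst_num_0 [simp]: "subst_num p q 0 = 0"
  by (simp add: subst_num_def)

lemma subst_num_const [simp]: "subst_num p q [:a:] = [:a:]"
  by (simp add: subst_num_def)

lemma subst_num_linear: "subst_num p q [:- c, 1:] = p - smult c q"
  by (simp add: subst_num_def)

lemma subst_num_X: "subst_num p q [:0, 1:] = p"
  using subst_num_linear[of p q 0] by simp

section \<open>Behaviour near infinity and continuity on the Berkovich line\<close>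

context nonarch_field
begin

lemma mult_seminorm_subst:
  assumes \<zeta>: "mult_seminorm v \<zeta>" and q: "\<zeta> q \<noteq> 0"
  shows "mult_seminorm v (\<lambda>f. \<zeta> (subst_num p q f) / \<zeta> q ^ degree f)"
    (is "mult_seminorm v ?\<eta>")
proof -
  note Z = mult_seminormD[OF nonarch \<zeta>]
  have q0: "q \<noteq> 0" using q Z(5) by auto
  have pos: "\<zeta> q > 0" using q Z(1)[of q] by linarith
  have pad: "?\<eta> f = \<zeta> (q ^ (N - degree f) * subst_num p q f) / \<zeta> q ^ N" if "degree f \<le> N" for f N
  proof -
    have "\<zeta> q ^ N = \<zeta> q ^ (N - degree f) * \<zeta> q ^ degree f" using that by (simp flip: power_add)
    thus ?thesis using q by (simp add: Z)
  qed
  show ?thesis unfolding mult_seminorm_def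
  proof (intro conjI allI)
    fix f g
    show "?\<eta> (f * g) = ?\<eta> f * ?\<eta> g"
      by (cases "f = 0 \<or> g = 0") (auto simp: Z subst_num_mult q0 degree_mult_eq power_add)
    define N where "N = max (degree f) (degree g)"
    have N: "degree f \<le> N" "degree g \<le> N" "degree (f + g) \<le> N"
      by (auto simp: N_def intro: degree_add_le)
    have "?\<eta> (f + g) = \<zeta> (q ^ (N - degree f) * subst_num p q f + q ^ (N - degree g) * subst_num p q g) / \<zeta> q ^ N"
      by (simp only: pad[OF N(3)] subst_num_add[OF q0 N(1,2)])
    also have "\<dots> \<le> max (?\<eta> f) (?\<eta> g)"
      unfolding pad[OF N(1)] pad[OF N(2)]
      by (rule order_trans[OF divide_right_mono[OF Z(4)]]) (use pos in \<open>auto simp: max_def\<close>)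
    finally show "?\<eta> (f + g) \<le> max (?\<eta> f) (?\<eta> g)" .
  qed (use pos in \<open>simp_all add: Z\<close>)
qed

text \<open>The leading term dominates once \<zeta>(z) is large; the induction peels off the
  constant term.\<close>

lemma seminorm_growth:
  assumes "f \<noteq> 0"
  shows "\<exists>R\<ge>1. \<forall>\<zeta>. mult_seminorm v \<zeta> \<longrightarrow> R \<le> \<zeta> [:0, 1:] \<longrightarrow>
           \<zeta> f = v (lead_coeff f) * \<zeta> [:0, 1:] ^ degree f"
  using assms
proof (induction f)
  case (pCons a f)
  show ?case
  proof (cases "f = 0")
    case True
    thus ?thesis by (intro exI[of _ 1]) (simp add: mult_seminorm_def)
  next
    case False
    then obtain R where R: "R \<ge> 1" "\<And>\<zeta>. mult_seminorm v \<zeta> \<Longrightarrow> R \<le> \<zeta> [:0, 1:] \<Longrightarrow>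
      \<zeta> f = v (lead_coeff f) * \<zeta> [:0, 1:] ^ degree f" using pCons.IH by blast
    let ?l = "v (lead_coeff f)"
    have l: "?l > 0" using False v_simps(1,2)[of "lead_coeff f"] by (metis leading_coeff_0_iff less_eq_real_def)
    \<comment> \<open>Beyond this radius \<open>v a < ?l * \<zeta> [:0, 1:]\<close>, so the constant
      term is strictly smaller than the rest and the ultrametric inequality is an equality.\<close>
    define R' where "R' = max R (v a / ?l + 1)"
    have "\<zeta> (pCons a f) = ?l * \<zeta> [:0, 1:] ^ Suc (degree f)"
      if \<zeta>: "mult_seminorm v \<zeta>" "R' \<le> \<zeta> [:0, 1:]" for \<zeta>
    proof -
      note Z = mult_seminormD[OF nonarch \<zeta>(1)]
      let ?z = "\<zeta> [:0, 1:]"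
      have z: "?z \<ge> R" "?z > v a / ?l" "?z \<ge> 1" using \<zeta>(2) R(1) by (auto simp: R'_def)
      have e: "\<zeta> ([:0, 1:] * f) = ?l * ?z ^ Suc (degree f)"
        unfolding Z(3) R(2)[OF \<zeta>(1) z(1)] by simp
      have "v a < ?l * ?z" using z(2) l by (simp add: field_simps)
      also have "\<dots> \<le> ?l * ?z ^ Suc (degree f)"
        using l z(3) by (intro mult_left_mono) (auto simp: self_le_power)
      finally have "\<zeta> [:a:] < \<zeta> ([:0, 1:] * f)" unfolding e Z(2) .
      from Z(10)[OF this] show ?thesis unfolding e by simp
    qed
    thus ?thesis using False R(1) by (intro exI[of _ R']) (auto simp: R'_def)
  qed
qed simp

lemma v_pos: "x \<noteq> 0 \<Longrightarrow> v x > 0"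
  using v_simps(1,2)[of x] by linarith

text \<open>Controls a rational map near infinity: with (f, g) = (q, p) when infinity is a pole, and
  with (p - c q, q) when its image is the finite point c.\<close>

lemma seminorm_ratio_at_infinity:
  assumes fg: "f = 0 \<or> degree f < degree g" "g \<noteq> 0" and \<epsilon>: "\<epsilon> > 0"
  shows "\<exists>R. \<forall>\<zeta>. mult_seminorm v \<zeta> \<longrightarrow> R < \<zeta> [:0, 1:] \<longrightarrow> \<zeta> g > 0 \<and> \<zeta> f < \<epsilon> * \<zeta> g"
proof -
  obtain R where R: "R \<ge> 1" "\<And>\<zeta>. mult_seminorm v \<zeta> \<Longrightarrow> R \<le> \<zeta> [:0, 1:] \<Longrightarrow>
      \<zeta> g = v (lead_coeff g) * \<zeta> [:0, 1:] ^ degree g" using seminorm_growth[OF fg(2)] by blast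
  have l: "v (lead_coeff g) > 0" using fg(2) v_pos by simp
  have pos: "\<zeta> g > 0" if \<zeta>: "mult_seminorm v \<zeta>" "R < \<zeta> [:0, 1:]" for \<zeta>
    using R(1) R(2)[OF \<zeta>(1)] \<zeta>(2) l by simp
  show ?thesis
  proof (cases "f = 0")
    case True
    thus ?thesis using pos \<epsilon> by (intro exI[of _ R]) (auto simp: mult_seminormD(5)[OF nonarch])
  next
    case False
    obtain S where S: "S \<ge> 1" "\<And>\<zeta>. mult_seminorm v \<zeta> \<Longrightarrow> S \<le> \<zeta> [:0, 1:] \<Longrightarrow>
      \<zeta> f = v (lead_coeff f) * \<zeta> [:0, 1:] ^ degree f" using seminorm_growth[OF False] by blast
    let ?T = "max (max R S) (v (lead_coeff f) / (\<epsilon> * v (lead_coeff g)))"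
    have "\<zeta> f < \<epsilon> * \<zeta> g" if \<zeta>: "mult_seminorm v \<zeta>" "?T < \<zeta> [:0, 1:]" for \<zeta>
    proof -
      let ?z = "\<zeta> [:0, 1:]"
      have z: "R \<le> ?z" "S \<le> ?z" "1 \<le> ?z" "v (lead_coeff f) / (\<epsilon> * v (lead_coeff g)) < ?z"
        using \<zeta>(2) R(1) by auto
      have "v (lead_coeff f) < \<epsilon> * v (lead_coeff g) * ?z" using z(4) \<epsilon> l by (simp add: field_simps)
      hence "v (lead_coeff f) * ?z ^ degree f < \<epsilon> * v (lead_coeff g) * ?z * ?z ^ degree f"
        using z(3) by (intro mult_strict_right_mono) auto
      also have "\<dots> = \<epsilon> * v (lead_coeff g) * ?z ^ Suc (degree f)" by simp
      also have "\<dots> \<le> \<epsilon> * v (lead_coeff g) * ?z ^ degree g"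
        using fg(1) False z(3) \<epsilon> l by (intro mult_left_mono power_increasing) auto
      finally show ?thesis using R(2)[OF \<zeta>(1) z(1)] S(2)[OF \<zeta>(1) z(2)] by simp
    qed
    thus ?thesis using pos by (intro exI[of _ ?T]) auto
  qed
qed

text \<open>By multiplicativity some linear factor of f is killed; so a point where the denominator
  vanishes is classical.\<close>

lemma seminorm_zero_linear:
  assumes \<zeta>: "mult_seminorm v \<zeta>"
  shows "f \<noteq> 0 \<Longrightarrow> \<zeta> f = 0 \<Longrightarrow> \<exists>a. \<zeta> [:- a, 1:] = 0"
proof (induction f rule: poly_linear_factor_induct)
  case (const c)
  thus ?case by (simp add: mult_seminormD(2)[OF nonarch \<zeta>] v_simps(2))
next
  case (linear a f)
  thus ?case unfolding mult_seminormD(3)[OF nonarch \<zeta>] by auto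
qed

lemma berk_rat_map_topspace:
  assumes "P \<in> topspace (berk_P1 v)"
  shows "berk_rat_map v \<phi> P \<in> topspace (berk_P1 v)"
proof (cases P)
  case None
  thus ?thesis using range_typeI_subset[OF nonarch] by (auto simp: berk_rat_map_def)
next
  case (Some \<zeta>)
  thus ?thesis using assms mult_seminorm_subst[of \<zeta> "rat_den \<phi>" "rat_num \<phi>"]
    by (auto simp: topspace_berk_P1 berk_rat_map_def)
qed

text \<open>Away from the poles each coordinate of the image is a quotient of evaluations with
  nonzero denominator, hence continuous.\<close>

lemma berk_rat_map_nhd_finite:
  assumes \<eta>: "mult_seminorm v \<eta>" "\<eta> (rat_den \<phi>) \<noteq> 0"
    and W: "openin (berk_P1 v) W" "berk_rat_map v \<phi> (Some \<eta>) \<in> W"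
  shows "\<exists>T. openin (berk_P1 v) T \<and> Some \<eta> \<in> T \<and> berk_rat_map v \<phi> ` T \<subseteq> W"
proof -
  let ?p = "rat_num \<phi>" and ?q = "rat_den \<phi>"
  let ?\<Phi> = "\<lambda>\<zeta> f. \<zeta> (subst_num ?p ?q f) / \<zeta> ?q ^ degree f"
  let ?U = "{\<zeta>. mult_seminorm v \<zeta> \<and> \<zeta> ?q > 0}"
  have U: "openin (berk_A1 v) ?U" by (rule openin_berk_A1_greater)
  have "continuous_on ?U ?\<Phi>"
    by (intro continuous_on_coordinatewise_then_product continuous_on_divide continuous_on_power
        continuous_on_seminorm_eval) auto
  hence cont: "continuous_map (top_of_set ?U) (berk_A1 v) ?\<Phi>"
    using mult_seminorm_subst by (fastforce simp: berk_A1_eq_top_of_set)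
  have sub: "subtopology (berk_A1 v) ?U = top_of_set ?U"
    by (auto simp: berk_A1_eq_top_of_set subtopology_subtopology intro!: arg_cong[where f = top_of_set])
  let ?V = "{\<zeta> \<in> ?U. ?\<Phi> \<zeta> \<in> {\<zeta>. mult_seminorm v \<zeta> \<and> Some \<zeta> \<in> W}}"
  have "openin (top_of_set ?U) ?V"
    using openin_continuous_map_preimage[OF cont openin_vimage_Some[OF W(1)]] by simp
  hence "openin (berk_A1 v) ?V" by (rule openin_trans_full[OF _ U, unfolded sub])
  hence "openin (berk_P1 v) (Some ` ?V)" by (rule openin_image_Some)
  moreover have "\<eta> ?q > 0" using \<eta>(2) mult_seminormD(1)[OF nonarch \<eta>(1), of ?q] by linarith
  hence "Some \<eta> \<in> Some ` ?V"
    using \<eta> W(2) mult_seminorm_subst[OF \<eta>] by (simp add: berk_rat_map_def)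
  moreover have "berk_rat_map v \<phi> ` Some ` ?V \<subseteq> W" by (auto simp: berk_rat_map_def)
  ultimately show ?thesis by blast
qed

text \<open>A pole is a classical point, where coprimality keeps the numerator p nonzero. Hence p
  exceeds any given multiple of q nearby, which drives the image to infinity.\<close>

lemma berk_rat_map_nhd_pole:
  assumes \<eta>: "mult_seminorm v \<eta>" "\<eta> (rat_den \<phi>) = 0"
    and W: "openin (berk_P1 v) W" "berk_rat_map v \<phi> (Some \<eta>) \<in> W"
  shows "\<exists>T. openin (berk_P1 v) T \<and> Some \<eta> \<in> T \<and> berk_rat_map v \<phi> ` T \<subseteq> W"
proof -
  note Z = mult_seminormD[OF nonarch \<eta>(1)]
  let ?p = "rat_num \<phi>" and ?q = "rat_den \<phi>"
  have "None \<in> W" using W(2) \<eta>(2) by (simp add: berk_rat_map_def)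
  from berk_nhd_infinity[OF W(1) this] obtain R where R: "R > 0"
    "\<And>\<zeta>. mult_seminorm v \<zeta> \<Longrightarrow> \<zeta> [:0, 1:] \<ge> R \<Longrightarrow> Some \<zeta> \<in> W" by blast
  have "\<eta> ?p \<noteq> 0"
  proof
    assume "\<eta> ?p = 0"
    obtain a where "\<eta> [:- a, 1:] = 0" using seminorm_zero_linear[OF \<eta>(1) lowest_terms(1) \<eta>(2)] by blast
    from mult_seminorm_linear_zero[OF nonarch \<eta>(1) this] have "poly ?p a = 0" "poly ?q a = 0"
      using \<open>\<eta> ?p = 0\<close> \<eta>(2) v_simps(2) by (metis, metis)
    thus False using lowest_terms_no_common_zero by blast
  qed
  hence pos: "\<eta> ?p > 0" using Z(1)[of ?p] by linarith
  let ?V = "{\<zeta>. mult_seminorm v \<zeta>} \<inter> {\<zeta>. R * \<zeta> ?q < \<zeta> ?p}"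
  have "open {\<zeta>::'a poly \<Rightarrow> real. R * \<zeta> ?q < \<zeta> ?p}"
    by (intro open_Collect_less continuous_intros continuous_on_seminorm_eval)
  hence "openin (berk_A1 v) ?V" unfolding openin_berk_A1_iff by blast
  hence "openin (berk_P1 v) (Some ` ?V)" by (rule openin_image_Some)
  moreover have "Some \<eta> \<in> Some ` ?V" using \<eta> pos by simp
  moreover have "berk_rat_map v \<phi> (Some \<zeta>) \<in> W" if \<zeta>: "mult_seminorm v \<zeta>" "R * \<zeta> ?q < \<zeta> ?p" for \<zeta>
  proof (cases "\<zeta> ?q = 0")
    case True
    thus ?thesis using \<open>None \<in> W\<close> by (simp add: berk_rat_map_def)
  next
    case False
    hence "\<zeta> ?q > 0" using mult_seminormD(1)[OF nonarch \<zeta>(1), of ?q] by linarith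
    hence "R \<le> \<zeta> ?p / \<zeta> ?q" using \<zeta>(2) by (simp add: field_simps)
    thus ?thesis using False R(2)[OF mult_seminorm_subst[OF \<zeta>(1) False]]
      by (simp add: berk_rat_map_def subst_num_X)
  qed
  hence "berk_rat_map v \<phi> ` Some ` ?V \<subseteq> W" by auto
  ultimately show ?thesis by blast
qed

lemma berk_rat_map_nhd_infinity:
  assumes W: "openin (berk_P1 v) W" "berk_rat_map v \<phi> None \<in> W"
  shows "\<exists>T. openin (berk_P1 v) T \<and> None \<in> T \<and> berk_rat_map v \<phi> ` T \<subseteq> W"
proof -
  let ?p = "rat_num \<phi>" and ?q = "rat_den \<phi>" and ?d = "rat_degree \<phi>"
  have q0: "?q \<noteq> 0" by (rule lowest_terms(1))
  have "\<exists>R. \<forall>\<zeta>. mult_seminorm v \<zeta> \<longrightarrow> \<zeta> [:0, 1:] > R \<longrightarrow> berk_rat_map v \<phi> (Some \<zeta>) \<in> W"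
  \<comment> \<open>This coefficient vanishes exactly when the map sends infinity to
    infinity.\<close>
  proof (cases "coeff ?q ?d = 0")
    case True
    hence "None \<in> W" using W(2) by (simp add: berk_rat_map_def typeI_def rat_map_def)
    from berk_nhd_infinity[OF W(1) this] obtain R where R: "R > 0"
      "\<And>\<zeta>. mult_seminorm v \<zeta> \<Longrightarrow> \<zeta> [:0, 1:] \<ge> R \<Longrightarrow> Some \<zeta> \<in> W" by blast
    have "degree ?q \<noteq> ?d" using True q0 leading_coeff_0_iff[of ?q] by metis
    hence deg: "degree ?q < degree ?p" by (auto simp: rat_degree_def max_def split: if_splits)
    hence "?p \<noteq> 0" by auto
    from seminorm_ratio_at_infinity[OF disjI2[OF deg] this, of "1 / R"] obtain S where
      S: "\<And>\<zeta>. mult_seminorm v \<zeta> \<Longrightarrow> S < \<zeta> [:0, 1:] \<Longrightarrow> \<zeta> ?q < 1 / R * \<zeta> ?p"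
      using R(1) by auto
    have "berk_rat_map v \<phi> (Some \<zeta>) \<in> W" if \<zeta>: "mult_seminorm v \<zeta>" "S < \<zeta> [:0, 1:]" for \<zeta>
    proof (cases "\<zeta> ?q = 0")
      case True
      thus ?thesis using \<open>None \<in> W\<close> by (simp add: berk_rat_map_def)
    next
      case False
      hence "\<zeta> ?q > 0" using mult_seminormD(1)[OF nonarch \<zeta>(1), of ?q] by linarith
      hence "R \<le> \<zeta> ?p / \<zeta> ?q" using S[OF \<zeta>] R(1) by (simp add: field_simps)
      thus ?thesis using False R(2)[OF mult_seminorm_subst[OF \<zeta>(1) False]]
        by (simp add: berk_rat_map_def subst_num_X)
    qed
    thus ?thesis by blast
  next
    case False
    define c where "c = coeff ?p ?d / coeff ?q ?d"
    have "typeI v (Some c) \<in> W" using W(2) False by (simp add: berk_rat_map_def rat_map_def c_def Let_def)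
    from berk_nhd_finite[OF W(1) this] obtain r where r: "r > 0"
      "\<And>\<zeta>. mult_seminorm v \<zeta> \<Longrightarrow> \<zeta> [:- c, 1:] \<le> r \<Longrightarrow> Some \<zeta> \<in> W" by blast
    have d: "degree ?q = ?d" using False by (metis le_degree max.cobounded2 order_antisym rat_degree_def)
    \<comment> \<open>Since \<open>c\<close> is the value at infinity, the coefficients of degree
      \<open>?d\<close> cancel, and \<open>?f\<close> is small compared with \<open>?q\<close> near
      infinity.\<close>
    let ?f = "?p - smult c ?q"
    have "degree ?f \<le> degree ?q" unfolding d
      by (intro degree_diff_le order_trans[OF degree_smult_le]) (auto simp: rat_degree_def)
    moreover have "coeff ?f (degree ?q) = 0" using False by (simp add: d c_def)
    ultimately have deg: "?f = 0 \<or> degree ?f < degree ?q"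
      by (metis leading_coeff_0_iff le_neq_implies_less)
    from seminorm_ratio_at_infinity[OF deg q0 r(1)] obtain S where
      S: "\<And>\<zeta>. mult_seminorm v \<zeta> \<Longrightarrow> S < \<zeta> [:0, 1:] \<Longrightarrow> \<zeta> ?q > 0 \<and> \<zeta> ?f < r * \<zeta> ?q"
      by blast
    have "berk_rat_map v \<phi> (Some \<zeta>) \<in> W" if \<zeta>: "mult_seminorm v \<zeta>" "S < \<zeta> [:0, 1:]" for \<zeta>
    proof -
      have pos: "\<zeta> ?q \<noteq> 0" and "\<zeta> ?f / \<zeta> ?q \<le> r" using S[OF \<zeta>] by (auto simp: field_simps)
      thus ?thesis using r(2)[OF mult_seminorm_subst[OF \<zeta>(1) pos]]
        by (simp add: berk_rat_map_def subst_num_linear)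
    qed
    thus ?thesis by blast
  qed
  then obtain R where R: "\<And>\<zeta>. mult_seminorm v \<zeta> \<Longrightarrow> \<zeta> [:0, 1:] > R \<Longrightarrow> berk_rat_map v \<phi> (Some \<zeta>) \<in> W"
    by blast
  show ?thesis
    by (intro exI[of _ "insert None (Some ` {\<zeta>. mult_seminorm v \<zeta> \<and> \<zeta> [:0, 1:] > R})"] conjI
        openin_berk_P1_at_infinity) (use R W(2) in auto)
qed

lemma continuous_map_berk_rat_map: "continuous_map (berk_P1 v) (berk_P1 v) (berk_rat_map v \<phi>)"
  unfolding continuous_map_def
proof (intro conjI allI impI)
  fix W assume W: "openin (berk_P1 v) W"
  let ?U = "{P \<in> topspace (berk_P1 v). berk_rat_map v \<phi> P \<in> W}"
  show "openin (berk_P1 v) ?U"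
  proof (subst openin_subopen, intro ballI)
    fix P assume P: "P \<in> ?U"
    have "\<exists>T. openin (berk_P1 v) T \<and> P \<in> T \<and> berk_rat_map v \<phi> ` T \<subseteq> W"
    proof (cases P)
      case None
      thus ?thesis using berk_rat_map_nhd_infinity[OF W] P by simp
    next
      case (Some \<eta>)
      thus ?thesis using berk_rat_map_nhd_finite[OF _ _ W, of \<eta>] berk_rat_map_nhd_pole[OF _ _ W, of \<eta>] P
        by (cases "\<eta> (rat_den \<phi>) = 0") (auto simp: topspace_berk_P1)
    qed
    thus "\<exists>T. openin (berk_P1 v) T \<and> P \<in> T \<and> T \<subseteq> ?U" using openin_subset by fastforce
  qed
qed (use berk_rat_map_topspace in auto)

lemma continuous_map_berk_twisted_iterate:
  assumes "\<tau> \<in> Aut_star v"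
  shows "continuous_map (berk_P1 v) (berk_P1 v) (berk_twisted_map v \<phi> \<tau> ^^ n)"
  unfolding berk_twisted_map_def
  by (intro continuous_map_iterate continuous_map_compose[OF _ continuous_map_berk_rat_map]
      homeomorphic_imp_continuous_map homeomorphic_map_berk_twist nonarch nontrivial assms)

lemma berk_twisted_iterate_typeI:
  assumes "\<tau> \<in> Aut_star v"
  shows "(berk_twisted_map v \<phi> \<tau> ^^ n) (typeI v P) = typeI v ((twisted_map \<phi> \<tau> ^^ n) P)"
  by (induction n) (simp_all add: berk_twisted_map_def twisted_map_def
      berk_twist_typeI[OF nonarch nontrivial assms] berk_rat_map_typeI[OF nonarch])

end

section \<open>Zero-free maps on a disk\<close>

definition proj_pt :: "'a::field \<Rightarrow> 'a \<Rightarrow> 'a proj_line" where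
  "proj_pt a b = (if b = 0 then None else Some (a / b))"

text \<open>The binary form of degree \<open>d\<close> with coefficients \<open>c\<close>. The
  general ring allows evaluation at field elements and at polynomials alike.\<close>

definition hom_eval :: "nat \<Rightarrow> (nat \<Rightarrow> 'b::comm_ring_1) \<Rightarrow> 'b \<Rightarrow> 'b \<Rightarrow> 'b" where
  "hom_eval d c x y = (\<Sum>i\<le>d. c i * x ^ i * y ^ (d - i))"

lemma poly_hom_eval:
  "poly (hom_eval d (\<lambda>i. [:c i:]) P Q) t = hom_eval d c (poly P t) (poly Q t)"
  by (simp add: hom_eval_def poly_sum mult.assoc)

lemma hom_eval_zero_right: "hom_eval d c x 0 = c d * x ^ d"
proof -
  have "hom_eval d c x 0 = (\<Sum>i\<in>{d}. c i * x ^ i * 0 ^ (d - i))"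
    unfolding hom_eval_def
    by (rule sum.mono_neutral_right) (auto simp: power_0_left)
  thus ?thesis by simp
qed

lemma hom_eval_poly:
  fixes f :: "'a::field poly"
  assumes y: "y \<noteq> 0" and d: "degree f \<le> d"
  shows "hom_eval d (coeff f) x y = y ^ d * poly f (x / y)"
proof -
  have "poly f (x / y) = (\<Sum>i\<le>d. coeff f i * (x / y) ^ i)"
    unfolding poly_altdef using d by (intro sum.mono_neutral_left) (auto simp: coeff_eq_0)
  hence "y ^ d * poly f (x / y) = (\<Sum>i\<le>d. y ^ d * (coeff f i * (x / y) ^ i))"
    by (simp add: sum_distrib_left)
  also have "\<dots> = hom_eval d (coeff f) x y"
    unfolding hom_eval_def
  proof (rule sum.cong)
    fix i assume "i \<in> {..d}"
    hence "y ^ d = y ^ i * y ^ (d - i)" by (simp flip: power_add)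
    thus "y ^ d * (coeff f i * (x / y) ^ i) = coeff f i * x ^ i * y ^ (d - i)"
      using y by (simp add: power_divide)
  qed simp
  finally show ?thesis by simp
qed

lemma rat_degree_ge: "degree (rat_num \<phi>) \<le> rat_degree \<phi>" "degree (rat_den \<phi>) \<le> rat_degree \<phi>"
  by (simp_all add: rat_degree_def)

lemma lead_coeffs_not_both_0: "coeff (rat_num \<phi>) (rat_degree \<phi>) \<noteq> 0 \<or> coeff (rat_den \<phi>) (rat_degree \<phi>) \<noteq> 0"
proof (cases "degree (rat_num \<phi>) \<le> degree (rat_den \<phi>)")
  case True
  thus ?thesis using lowest_terms(1)[of \<phi>] by (simp add: rat_degree_def max_def)
next
  case False
  hence "rat_num \<phi> \<noteq> 0" by auto
  thus ?thesis using False by (simp add: rat_degree_def max_def)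
qed

lemma rat_map_proj_pt:
  fixes a b :: "'a::field_char_0"
  assumes "a \<noteq> 0 \<or> b \<noteq> 0"
  shows "rat_map \<phi> (proj_pt a b) = proj_pt (hom_eval (rat_degree \<phi>) (coeff (rat_num \<phi>)) a b)
      (hom_eval (rat_degree \<phi>) (coeff (rat_den \<phi>)) a b)"
    and "hom_eval (rat_degree \<phi>) (coeff (rat_num \<phi>)) a b \<noteq> 0 \<or>
      hom_eval (rat_degree \<phi>) (coeff (rat_den \<phi>)) a b \<noteq> 0"
proof -
  show "rat_map \<phi> (proj_pt a b) = proj_pt (hom_eval (rat_degree \<phi>) (coeff (rat_num \<phi>)) a b)
      (hom_eval (rat_degree \<phi>) (coeff (rat_den \<phi>)) a b)"
  proof (cases "b = 0")
    case True
    thus ?thesis using assms by (auto simp: proj_pt_def rat_map_def Let_def hom_eval_zero_right)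
  next
    case False
    thus ?thesis by (simp add: proj_pt_def rat_map_def Let_def hom_eval_poly rat_degree_ge)
  qed
  show "hom_eval (rat_degree \<phi>) (coeff (rat_num \<phi>)) a b \<noteq> 0 \<or>
      hom_eval (rat_degree \<phi>) (coeff (rat_den \<phi>)) a b \<noteq> 0"
  proof (cases "b = 0")
    case True
    thus ?thesis using assms lead_coeffs_not_both_0[of \<phi>] by (auto simp: hom_eval_zero_right)
  next
    case False
    thus ?thesis using lowest_terms_no_common_zero[of \<phi> "a / b"] by (auto simp: hom_eval_poly rat_degree_ge)
  qed
qed

lemma field_automorphism_divide:
  assumes "field_automorphism \<tau>"
  shows "\<tau> x = 0 \<longleftrightarrow> x = 0" "\<tau> (x / y) = \<tau> x / \<tau> y"
proof -
  note t = field_automorphismD[OF assms]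
  show z: "\<tau> x = 0 \<longleftrightarrow> x = 0" for x using t(1,5) by (metis bij_is_inj injD)
  show "\<tau> (x / y) = \<tau> x / \<tau> y"
  proof (cases "y = 0")
    case False
    have "\<tau> (x / y) * \<tau> y = \<tau> x" using False by (simp flip: t(4))
    thus ?thesis using False z by (simp add: field_simps)
  qed (simp add: t(5))
qed

lemma map_option_proj_pt:
  assumes "field_automorphism \<tau>"
  shows "map_option \<tau> (proj_pt a b) = proj_pt (\<tau> a) (\<tau> b)"
  by (simp add: proj_pt_def field_automorphism_divide[OF assms])

text \<open>Since \<tau>(P(t)) is the conjugated polynomial evaluated at \<tau>(t), all twists can
  be moved into the argument, leaving polynomials in \<tau>^n(t). The absence of common zeros is
  carried along to keep the coordinates meaningful.\<close>

lemma twisted_iterate_proj_pt: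
  fixes P Q :: "'a::field_char_0 poly"
  assumes \<tau>: "field_automorphism \<tau>" and PQ: "\<And>t. poly P t \<noteq> 0 \<or> poly Q t \<noteq> 0"
  shows "\<exists>P' Q'. (\<forall>t. poly P' t \<noteq> 0 \<or> poly Q' t \<noteq> 0) \<and>
    (\<forall>t. (twisted_map \<phi> \<tau> ^^ n) (proj_pt (poly P t) (poly Q t)) =
         proj_pt (poly P' ((\<tau> ^^ n) t)) (poly Q' ((\<tau> ^^ n) t)))"
proof (induction n)
  case 0
  show ?case using PQ by (intro exI[of _ P] exI[of _ Q]) simp
next
  case (Suc n)
  then obtain P' Q' where PQ': "\<And>t. poly P' t \<noteq> 0 \<or> poly Q' t \<noteq> 0"
    "\<And>t. (twisted_map \<phi> \<tau> ^^ n) (proj_pt (poly P t) (poly Q t)) =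
         proj_pt (poly P' ((\<tau> ^^ n) t)) (poly Q' ((\<tau> ^^ n) t))" by blast
  define A where "A = map_poly \<tau> P'"
  define B where "B = map_poly \<tau> Q'"
  have AB: "poly A (\<tau> t) = \<tau> (poly P' t)" "poly B (\<tau> t) = \<tau> (poly Q' t)" for t
    by (simp_all add: A_def B_def poly_map_poly_automorphism[OF \<tau>])
  have nz: "poly A s \<noteq> 0 \<or> poly B s \<noteq> 0" for s
  proof -
    obtain t where "s = \<tau> t" using field_automorphismD(1)[OF \<tau>] by (metis bij_pointE)
    thus ?thesis using PQ'(1)[of t] by (simp add: AB field_automorphism_divide(1)[OF \<tau>])
  qed
  let ?H = "\<lambda>f. hom_eval (rat_degree \<phi>) (\<lambda>i. [:coeff f i:]) A B"
  show ?case
  proof (rule exI[of _ "?H (rat_num \<phi>)"], rule exI[of _ "?H (rat_den \<phi>)"], intro conjI allI)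
    show "poly (?H (rat_num \<phi>)) t \<noteq> 0 \<or> poly (?H (rat_den \<phi>)) t \<noteq> 0" for t
      unfolding poly_hom_eval by (rule rat_map_proj_pt(2)[OF nz])
    fix t
    have "(twisted_map \<phi> \<tau> ^^ Suc n) (proj_pt (poly P t) (poly Q t)) =
      rat_map \<phi> (proj_pt (poly A ((\<tau> ^^ Suc n) t)) (poly B ((\<tau> ^^ Suc n) t)))"
      by (simp add: PQ'(2)) (simp add: twisted_map_def map_option_proj_pt[OF \<tau>] AB)
    also have "\<dots> = proj_pt (poly (?H (rat_num \<phi>)) ((\<tau> ^^ Suc n) t)) (poly (?H (rat_den \<phi>)) ((\<tau> ^^ Suc n) t))"
      unfolding poly_hom_eval by (rule rat_map_proj_pt(1)[OF nz])
    finally show "(twisted_map \<phi> \<tau> ^^ Suc n) (proj_pt (poly P t) (poly Q t)) =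
      proj_pt (poly (?H (rat_num \<phi>)) ((\<tau> ^^ Suc n) t)) (poly (?H (rat_den \<phi>)) ((\<tau> ^^ Suc n) t))" .
  qed
qed

context nonarch_field
begin

lemma max_v_divide: "d \<noteq> 0 \<Longrightarrow> max (v c) (v d) = v d * max 1 (v (c / d))"
  using v_pos[of d] by (simp add: v_divide max_def field_simps)

text \<open>The homogeneous formula treats infinity like any other point, so later estimates need no
  cases.\<close>

lemma sph_dist_proj_pt:
  assumes "a \<noteq> 0 \<or> b \<noteq> 0" "c \<noteq> 0 \<or> d \<noteq> 0"
  shows "sph_dist v (proj_pt a b) (proj_pt c d) =
    v (a * d - c * b) / (max (v a) (v b) * max (v c) (v d))"
proof -
  have mz: "max (v x) (v 0) = v x" for x using v_simps(1)[of x] by (simp add: v_simps(5))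
  consider "b = 0" "d = 0" | "b = 0" "d \<noteq> 0" | "b \<noteq> 0" "d = 0" | "b \<noteq> 0" "d \<noteq> 0" by blast
  thus ?thesis
  proof cases
    case 1
    thus ?thesis by (simp add: proj_pt_def v_simps(5))
  next
    case 2
    hence "v a > 0" "v d > 0" using assms v_pos by auto
    thus ?thesis using 2 mz[of a] by (simp add: proj_pt_def max_v_divide v_simps(3) del: max_def)
  next
    case 3
    hence "v c > 0" "v b > 0" using assms v_pos by auto
    thus ?thesis using 3 mz[of c] by (simp add: proj_pt_def max_v_divide v_simps(3,7))
  next
    case 4
    hence pos: "v b > 0" "v d > 0" using v_pos by auto
    have "a / b - c / d = (a * d - c * b) / (b * d)" using 4 by (simp add: field_simps)
    thus ?thesis using 4 pos by (simp add: proj_pt_def max_v_divide v_divide v_simps(3) mult_ac)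
  qed
qed

text \<open>Every root a lies outside the disk, so |s - a| = |a| > \<rho> throughout it. Each factor
  thus varies by a relative amount of at most |t - t'| / \<rho>, and the ultrametric inequality
  keeps this bound for products.\<close>

lemma poly_zero_free_variation:
  assumes \<rho>: "\<rho> > 0" and t: "v t \<le> \<rho>" "v t' \<le> \<rho>"
  shows "(\<And>s. v s \<le> \<rho> \<Longrightarrow> poly A s \<noteq> 0) \<Longrightarrow>
    v (poly A t) = v (poly A t') \<and> v (poly A t - poly A t') \<le> v (poly A t') * (v (t - t') / \<rho>)"
proof (induction A rule: poly_linear_factor_induct)
  case (const c)
  show ?case using v_simps(1) \<rho> by (simp add: v_simps(5))
next
  case (linear a A)
  have r: "poly ([:- a, 1:] * A) s = (s - a) * poly A s" for s by (simp add: algebra_simps)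
  have "poly A s \<noteq> 0" if "v s \<le> \<rho>" for s using linear.prems[OF that] unfolding r by simp
  note IH = linear.IH[OF this]
  have a: "v a > \<rho>" using linear.prems[of a] unfolding r by force
  have va: "v (s - a) = v a" if "v s \<le> \<rho>" for s
    using v_add_eq[of s "- a"] that a by (simp add: v_simps(7))
  let ?\<delta> = "v (t - t')"
  have "(t - a) * poly A t - (t' - a) * poly A t' =
    (t - a) * (poly A t - poly A t') + (t - t') * poly A t'" by (simp add: algebra_simps)
  hence "v ((t - a) * poly A t - (t' - a) * poly A t') \<le>
    max (v a * v (poly A t - poly A t')) (?\<delta> * v (poly A t'))"
    using v_simps(4) va[OF t(1)] by (simp add: v_simps(3)[symmetric] flip: v_simps(3)) (metis v_simps(3,4))
  also have "\<dots> \<le> v a * v (poly A t') * (?\<delta> / \<rho>)"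
  proof (rule max.boundedI)
    show "v a * v (poly A t - poly A t') \<le> v a * v (poly A t') * (?\<delta> / \<rho>)"
      using mult_left_mono[OF conjunct2[OF IH] v_simps(1)[of a]] by (simp add: mult.assoc)
    have "?\<delta> * v (poly A t') * \<rho> \<le> ?\<delta> * v (poly A t') * v a"
      using a v_simps(1) by (intro mult_left_mono) auto
    thus "?\<delta> * v (poly A t') \<le> v a * v (poly A t') * (?\<delta> / \<rho>)" using \<rho> by (simp add: field_simps)
  qed
  finally show ?case unfolding r using conjunct1[OF IH] by (simp add: v_simps(3) va t)
qed

text \<open>Hsia's non-archimedean Montel theorem for a single map: \<open>P - b Q\<close> and \<open>P - c Q\<close> are
  zero-free, hence nearly constant, and their cross ratio recovers the spherical distance.\<close>

lemma sph_dist_omitting: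
  assumes \<rho>: "\<rho> > 0" and t: "v t \<le> \<rho>" "v t' \<le> \<rho>"
    and PQ: "\<And>s. poly P s \<noteq> 0 \<or> poly Q s \<noteq> 0"
    and omit: "\<And>s. v s \<le> \<rho> \<Longrightarrow> proj_pt (poly P s) (poly Q s) \<noteq> Some b"
      "\<And>s. v s \<le> \<rho> \<Longrightarrow> proj_pt (poly P s) (poly Q s) \<noteq> Some c"
    and bc: "b \<noteq> c" and M: "1 \<le> M" "v b \<le> M" "v c \<le> M"
  shows "sph_dist v (proj_pt (poly P t) (poly Q t)) (proj_pt (poly P t') (poly Q t')) \<le>
    M\<^sup>2 / v (b - c) * (v (t - t') / \<rho>)"
proof -
  define m where "m s = max (v (poly P s)) (v (poly Q s))" for s
  have m: "m s > 0" for s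
    using PQ[of s] v_pos[of "poly P s"] v_pos[of "poly Q s"] by (auto simp: m_def less_max_iff_disj)
  define A where "A = P - smult b Q"
  define B where "B = P - smult c Q"
  let ?\<delta> = "v (t - t') / \<rho>"
  have nz: "poly (P - smult e Q) s \<noteq> 0" if "proj_pt (poly P s) (poly Q s) \<noteq> Some e" for e s
  proof
    assume 0: "poly (P - smult e Q) s = 0"
    hence "poly Q s \<noteq> 0" using PQ[of s] by auto
    thus False using that 0 by (simp add: proj_pt_def field_simps)
  qed
  have le: "v (poly (P - smult e Q) s) \<le> M * m s" if "v e \<le> M" for e s
  proof -
    have "v (poly (P - smult e Q) s) \<le> max (v (poly P s)) (v e * v (poly Q s))"
      using v_diff_le[of "poly P s" "e * poly Q s"] by (simp add: v_simps(3))
    also have "\<dots> \<le> M * m s"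
    proof (rule max.boundedI)
      show "v (poly P s) \<le> M * m s" using mult_mono[OF M(1), of "v (poly P s)" "m s"] M(1) v_simps(1)
        by (auto simp: m_def)
      show "v e * v (poly Q s) \<le> M * m s"
        using mult_mono[OF that, of "v (poly Q s)" "m s"] M(1) v_simps(1) by (auto simp: m_def)
    qed
    finally show ?thesis .
  qed
  have A: "v (poly A t) = v (poly A t')" "v (poly A t - poly A t') \<le> v (poly A t') * ?\<delta>"
    using poly_zero_free_variation[OF \<rho> t nz[OF omit(1)]] by (auto simp: A_def)
  have B: "v (poly B t) = v (poly B t')" "v (poly B t - poly B t') \<le> v (poly B t') * ?\<delta>"
    using poly_zero_free_variation[OF \<rho> t nz[OF omit(2)]] by (auto simp: B_def)
  let ?D = "poly P t * poly Q t' - poly P t' * poly Q t"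
  \<comment> \<open>Passing from (P, Q) to (A, B) is linear with determinant b - c up to sign, which
    scales the 2 by 2 determinant \<open>?D\<close>.\<close>
  have "v (b - c) * v ?D = v (poly A t * poly B t' - poly A t' * poly B t)"
    by (simp add: A_def B_def flip: v_simps(3)) (simp add: algebra_simps)
  also have "poly A t * poly B t' - poly A t' * poly B t =
    (poly A t - poly A t') * poly B t - poly A t * (poly B t - poly B t')" by (simp add: algebra_simps)
  also have "v \<dots> \<le> max (v (poly A t - poly A t') * v (poly B t)) (v (poly A t) * v (poly B t - poly B t'))"
    by (rule order_trans[OF v_diff_le]) (simp add: v_simps(3))
  also have "\<dots> \<le> v (poly A t) * v (poly B t') * ?\<delta>"
  proof (rule max.boundedI)
    show "v (poly A t - poly A t') * v (poly B t) \<le> v (poly A t) * v (poly B t') * ?\<delta>"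
      using mult_right_mono[OF A(2) v_simps(1)[of "poly B t"]] by (simp add: A(1) B(1) mult_ac)
    show "v (poly A t) * v (poly B t - poly B t') \<le> v (poly A t) * v (poly B t') * ?\<delta>"
      using mult_left_mono[OF B(2) v_simps(1)[of "poly A t"]] by (simp add: mult_ac)
  qed
  also have "\<dots> \<le> (M * m t) * (M * m t') * ?\<delta>"
    using le[OF M(2), of t] le[OF M(3), of t'] v_simps(1) \<rho> M(1) m[of t]
    by (intro mult_right_mono mult_mono) (auto simp: A_def B_def)
  finally have le: "v (b - c) * v ?D \<le> M\<^sup>2 * ?\<delta> * (m t * m t')" by (simp add: power2_eq_square mult_ac)
  have "X / k \<le> C / V" if "V * X \<le> C * k" "V > 0" "k > 0" for X k C V :: real
    using that by (simp add: field_simps)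
  from this[OF le _ mult_pos_pos[OF m m]] have "v ?D / (m t * m t') \<le> M\<^sup>2 * ?\<delta> / v (b - c)"
    using bc v_pos by simp
  thus ?thesis unfolding sph_dist_proj_pt[OF PQ PQ] m_def by (simp add: mult.commute)
qed

end

section \<open>Comparison of the Fatou sets\<close>

text \<open>Supplies, for two distinct omitted points, a centre a at which their distances to a
  differ.\<close>

lemma mult_seminorm_eq_iff_linear:
  fixes v :: "'a::alg_closed_field \<Rightarrow> real"
  assumes "mult_seminorm v \<zeta>" "mult_seminorm v \<eta>" "\<And>a. \<zeta> [:- a, 1:] = \<eta> [:- a, 1:]"
  shows "\<zeta> = \<eta>"
proof
  show "\<zeta> f = \<eta> f" for f
  proof (induction f rule: poly_linear_factor_induct)
    case (const c)
    thus ?case using assms(1,2) by (simp add: mult_seminorm_def)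
  next
    case (linear a f)
    have "\<zeta> ([:- a, 1:] * f) = \<zeta> [:- a, 1:] * \<zeta> f" "\<eta> ([:- a, 1:] * f) = \<eta> [:- a, 1:] * \<eta> f"
      using assms(1,2) unfolding mult_seminorm_def by blast+
    thus ?case using linear.IH assms(3) by simp
  qed
qed

lemma field_automorphism_funpow:
  assumes "field_automorphism \<tau>"
  shows "(\<tau> ^^ n) (x - y) = (\<tau> ^^ n) x - (\<tau> ^^ n) y" "surj (\<tau> ^^ n)"
proof -
  note t = field_automorphismD[OF assms]
  show "(\<tau> ^^ n) (x - y) = (\<tau> ^^ n) x - (\<tau> ^^ n) y" by (induction n) (simp_all add: t)
  show "surj (\<tau> ^^ n)" using t(1) by (intro bij_is_surj bij_fn)
qed

text \<open>Homogeneous coordinates of a local parametrisation of the projective line at a point.\<close>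

definition chart :: "'a::field proj_line \<Rightarrow> 'a poly \<times> 'a poly" where
  "chart x = (case x of None \<Rightarrow> ([:1:], [:0, 1:]) | Some c \<Rightarrow> ([:c, 1:], [:1:]))"

definition chart_pt :: "'a::field proj_line \<Rightarrow> 'a \<Rightarrow> 'a proj_line" where
  "chart_pt x t = proj_pt (poly (fst (chart x)) t) (poly (snd (chart x)) t)"

lemma chart_nonzero: "poly (fst (chart x)) t \<noteq> 0 \<or> poly (snd (chart x)) t \<noteq> 0"
  by (cases x) (simp_all add: chart_def)

lemma chart_pt_None: "chart_pt None t = (if t = 0 then None else Some (1 / t))"
  by (simp add: chart_pt_def chart_def proj_pt_def)

lemma chart_pt_Some: "chart_pt (Some c) t = Some (c + t)"
  by (simp add: chart_pt_def chart_def proj_pt_def)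

context nonarch_field
begin

lemma twist_iterate_abs:
  assumes "\<tau> \<in> Aut_star v"
  shows "v ((\<tau> ^^ n) x) = v x powr (twist_exp v \<tau> ^ n)"
proof (induction n)
  case 0
  show ?case using v_simps(1) by simp
next
  case (Suc n)
  thus ?case using twist_exp(2)[OF nonarch nontrivial assms] by (simp add: powr_powr mult.commute)
qed

lemma sph_dist_self: "sph_dist v x x = 0"
  by (cases x) (simp_all add: v_simps(5))

text \<open>The determinant of two coordinate pairs is t - t' up to sign, and the coordinates are
  bounded on the unit disk; the homogeneous distance formula then gives a Lipschitz inverse.\<close>

lemma chart_dist:
  "\<exists>M\<ge>1. \<forall>t t'. v t \<le> 1 \<longrightarrow> v t' \<le> 1 \<longrightarrow> v (t - t') \<le> M * sph_dist v (chart_pt x t) (chart_pt x t')"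
proof -
  define M where "M = (case x of None \<Rightarrow> 1 | Some c \<Rightarrow> max 1 (v c))"
  let ?m = "\<lambda>t. max (v (poly (fst (chart x)) t)) (v (poly (snd (chart x)) t))"
  have M1: "M \<ge> 1" by (auto simp: M_def split: option.splits)
  have m: "?m t \<le> M" if "v t \<le> 1" for t
  proof (cases x)
    case None
    thus ?thesis using that by (simp add: chart_def M_def v_simps)
  next
    case (Some c)
    thus ?thesis using that v_simps(4)[of c t] by (simp add: chart_def M_def v_simps(6))
  qed
  have mpos: "?m t > 0" for t
    using chart_nonzero[of x t] v_pos by (auto simp: less_max_iff_disj)
  have D: "v (poly (fst (chart x)) t * poly (snd (chart x)) t' - poly (fst (chart x)) t' * poly (snd (chart x)) t)
    = v (t - t')" for t t'
    by (cases x) (simp_all add: chart_def v_simps(8))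
  have "v (t - t') \<le> M * M * sph_dist v (chart_pt x t) (chart_pt x t')" if "v t \<le> 1" "v t' \<le> 1" for t t'
  proof -
    have "sph_dist v (chart_pt x t) (chart_pt x t') = v (t - t') / (?m t * ?m t')"
      unfolding chart_pt_def sph_dist_proj_pt[OF chart_nonzero chart_nonzero] D by (rule refl)
    hence "v (t - t') = ?m t * ?m t' * sph_dist v (chart_pt x t) (chart_pt x t')"
      using mpos[of t] mpos[of t'] by simp
    also have "\<dots> \<le> M * M * sph_dist v (chart_pt x t) (chart_pt x t')"
      using m that M1 mpos[of t] mpos[of t'] Metric_space.nonneg[OF Metric_space_sph_dist[OF nonarch]]
      by (intro mult_right_mono mult_mono) (auto intro: less_imp_le)
    finally show ?thesis .
  qed
  thus ?thesis using M1 mult_mono[OF M1 M1] by (intro exI[of _ "M * M"]) auto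
qed

lemma chart_surj:
  assumes r: "0 < r" "r \<le> 1"
  shows "\<exists>e>0. \<forall>y. sph_dist v x y < e \<longrightarrow> (\<exists>t. v t < r \<and> y = chart_pt x t)"
proof (cases x)
  case None
  have "\<exists>t. v t < r \<and> y = chart_pt x t" if y: "sph_dist v x y < r" for y
  proof (cases y)
    case None
    thus ?thesis using \<open>x = None\<close> r by (intro exI[of _ 0]) (simp add: chart_pt_None v_simps(5))
  next
    case (Some b)
    have "1 / max 1 (v b) < r" using y \<open>x = None\<close> Some by simp
    hence b: "1 < r * max 1 (v b)" by (simp add: field_simps)
    moreover have "r * max 1 (v b) \<le> 1 * max 1 (v b)" using r by (intro mult_right_mono) auto
    ultimately have "v b > 1" by linarith
    hence "b \<noteq> 0" "1 / v b < r" using b v_simps(5) by (auto simp: v_simps(5) field_simps)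
    thus ?thesis using \<open>x = None\<close> Some
      by (intro exI[of _ "1 / b"]) (simp add: chart_pt_None v_divide v_simps(6))
  qed
  thus ?thesis using r(1) by blast
next
  case (Some c)
  let ?m = "max 1 (v c)"
  have m: "?m \<ge> 1" "v c \<le> ?m" by auto
  \<comment> \<open>Infinity and the points with \<open>v b > ?m\<close> all have distance exactly
    \<open>1 / ?m\<close> from \<open>x\<close>, which this radius excludes. For the others the
    denominator is at most \<open>?m * ?m\<close>.\<close>
  have "\<exists>t. v t < r \<and> y = chart_pt x t" if y: "sph_dist v x y < r / (?m * ?m)" for y
  proof -
    have small: "sph_dist v x y < 1 / ?m"
    proof -
      have "r / (?m * ?m) \<le> 1 / (?m * 1)" using r m by (intro frac_le mult_mono) auto
      thus ?thesis using y by simp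
    qed
    then obtain b where b: "y = Some b" using Some by (cases y) auto
    have d: "sph_dist v x y = v (c - b) / (?m * max 1 (v b))" using Some b by simp
    have "v b \<le> ?m"
    proof (rule ccontr)
      assume n: "\<not> v b \<le> ?m"
      hence "v (c - b) = v b" using v_add_eq[of c "- b"] by (simp add: v_simps(7))
      moreover have "max 1 (v b) = v b" using n by simp
      ultimately have "sph_dist v x y = 1 / ?m" unfolding d using n by simp
      thus False using small by simp
    qed
    hence "v (c - b) / (?m * ?m) \<le> sph_dist v x y"
      unfolding d using v_simps(1)[of "c - b"] by (intro divide_left_mono mult_left_mono mult_pos_pos) auto
    hence "v (c - b) / (?m * ?m) < r / (?m * ?m)" using y by simp
    hence "v (c - b) < r" using m(1) by (simp add: divide_less_cancel mult_less_0_iff)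
    thus ?thesis using Some b by (intro exI[of _ "b - c"]) (simp add: chart_pt_Some v_simps(8))
  qed
  moreover have "r / (?m * ?m) > 0" using r(1) m(1) by simp
  ultimately show ?thesis by blast
qed

text \<open>\<open>D\<close> is a closed disk around a finite point, and the complement of an open
  disk around 0 for infinity. Closedness makes its images under the iterates closed later
  on.\<close>

lemma berk_chart_nhd:
  assumes W: "openin (berk_P1 v) W" "typeI v x \<in> W"
  shows "\<exists>r D. 0 < r \<and> r \<le> 1 \<and> closedin (berk_P1 v) D \<and> D \<subseteq> W \<and> (\<forall>t. v t \<le> r \<longrightarrow> typeI v (chart_pt x t) \<in> D)"
proof (cases x)
  case (Some c)
  obtain r where r: "r > 0" "\<And>\<zeta>. mult_seminorm v \<zeta> \<Longrightarrow> \<zeta> [:- c, 1:] \<le> r \<Longrightarrow> Some \<zeta> \<in> W"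
    using berk_nhd_finite[OF W(1)] W(2) Some by blast
  let ?r = "min r 1"
  let ?K = "{\<zeta>. mult_seminorm v \<zeta> \<and> \<zeta> [:- c, 1:] \<le> ?r}"
  have "compactin (berk_A1 v) ?K" using compact_berk_disk[of c ?r] unfolding compactin_berk_A1_iff by blast
  hence "compactin (berk_P1 v) (Some ` ?K)"
    unfolding berk_P1_def by (rule image_compactin[OF _ continuous_map_Some])
  hence "closedin (berk_P1 v) (Some ` ?K)" by (rule compactin_imp_closedin[OF Hausdorff_berk_P1])
  moreover have "typeI v (chart_pt x t) \<in> Some ` ?K" if "v t \<le> ?r" for t
    using that mult_seminorm_typeI[OF nonarch, of "c + t"] Some by (simp add: chart_pt_Some typeI_def)
  moreover have "Some ` ?K \<subseteq> W" using r(2) by auto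
  ultimately show ?thesis using r(1) by (intro exI[of _ ?r] exI[of _ "Some ` ?K"]) simp
next
  case None
  obtain R where R: "R > 0" "\<And>\<zeta>. mult_seminorm v \<zeta> \<Longrightarrow> \<zeta> [:0, 1:] \<ge> R \<Longrightarrow> Some \<zeta> \<in> W"
    using berk_nhd_infinity[OF W(1)] W(2) None by (auto simp: typeI_def)
  let ?R = "max R 1"
  let ?O = "{\<zeta>. mult_seminorm v \<zeta> \<and> \<zeta> [:0, 1:] < ?R}"
  let ?D = "topspace (berk_P1 v) - Some ` ?O"
  have "closedin (berk_P1 v) ?D" by (intro closedin_diff openin_image_Some openin_berk_A1_less) auto
  moreover have "?D \<subseteq> W"
  proof
    fix P assume P: "P \<in> ?D"
    show "P \<in> W"
    proof (cases P)
      case None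
      thus ?thesis using W(2) \<open>x = None\<close> by (simp add: typeI_def)
    next
      case (Some \<zeta>)
      hence "mult_seminorm v \<zeta>" "\<not> \<zeta> [:0, 1:] < ?R" using P by (auto simp: topspace_berk_P1)
      thus ?thesis using R(2)[of \<zeta>] Some by simp
    qed
  qed
  moreover have "typeI v (chart_pt x t) \<in> ?D" if t: "v t \<le> 1 / ?R" for t
  proof (cases "t = 0")
    case True
    thus ?thesis using None by (auto simp: chart_pt_None typeI_def topspace_berk_P1)
  next
    case False
    hence "v t > 0" by (rule v_pos)
    moreover have "?R > 0" by simp
    ultimately have "?R \<le> 1 / v t" using t by (metis mult.commute pos_le_divide_eq)
    thus ?thesis using False None mult_seminorm_typeI[OF nonarch, of "1 / t"]
      by (auto simp: chart_pt_None typeI_def topspace_berk_P1 v_divide v_simps(6))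
  qed
  moreover have "0 < 1 / ?R" "1 / ?R \<le> 1" by auto
  ultimately show ?thesis by blast
qed

lemma neighborhood_sph_iff:
  "neighborhood (sph_topology v) x U \<longleftrightarrow> (\<exists>e>0. \<forall>y. sph_dist v x y < e \<longrightarrow> y \<in> U)"
proof -
  interpret Metric_space UNIV "sph_dist v" by (rule Metric_space_sph_dist[OF nonarch])
  have "(\<exists>V. openin mtopology V \<and> x \<in> V \<and> V \<subseteq> U) \<longleftrightarrow> (\<exists>e>0. mball x e \<subseteq> U)"
  proof
    assume "\<exists>e>0. mball x e \<subseteq> U"
    then obtain e where "e > 0" "mball x e \<subseteq> U" by blast
    thus "\<exists>V. openin mtopology V \<and> x \<in> V \<and> V \<subseteq> U" by (intro exI[of _ "mball x e"]) auto
  next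
    assume "\<exists>V. openin mtopology V \<and> x \<in> V \<and> V \<subseteq> U"
    thus "\<exists>e>0. mball x e \<subseteq> U" unfolding openin_mtopology by (meson order_trans)
  qed
  thus ?thesis by (auto simp: neighborhood_def sph_topology_def subset_iff)
qed

lemma berk_nhd_in_sph_ball:
  assumes e: "e > 0"
  shows "\<exists>B. openin (berk_P1 v) B \<and> typeI v x \<in> B \<and> (\<forall>y. typeI v y \<in> B \<longrightarrow> sph_dist v x y < e)"
proof (cases x)
  case (Some c)
  let ?U = "{\<zeta>. mult_seminorm v \<zeta> \<and> \<zeta> [:- c, 1:] < e}"
  have "sph_dist v x y < e" if y: "typeI v y \<in> Some ` ?U" for y
  proof -
    obtain b where b: "y = Some b" "v (b - c) < e" using y by (cases y) (auto simp: typeI_def)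
    have "v (c - b) / (max 1 (v c) * max 1 (v b)) \<le> v (c - b) / (1 * 1)"
      using v_simps(1) by (intro divide_left_mono mult_mono) auto
    thus ?thesis using b Some by (simp add: v_simps(8)[of b c])
  qed
  moreover have "typeI v x \<in> Some ` ?U"
    using Some e mult_seminorm_typeI[OF nonarch, of c] by (simp add: typeI_def v_simps(5))
  ultimately show ?thesis using openin_image_Some[OF openin_berk_A1_less] by blast
next
  case None
  let ?B = "insert None (Some ` {\<zeta>. mult_seminorm v \<zeta> \<and> \<zeta> [:0, 1:] > 1 / e})"
  have "sph_dist v x y < e" if y: "typeI v y \<in> ?B" for y
  proof (cases y)
    case None
    thus ?thesis using \<open>x = None\<close> e by simp
  next
    case (Some b)
    hence "v b > 1 / e" using y by (auto simp: typeI_def)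
    hence "max 1 (v b) > 1 / e" by simp
    thus ?thesis using \<open>x = None\<close> Some e by (simp add: field_simps)
  qed
  thus ?thesis using openin_berk_P1_at_infinity[of "1 / e"] None by (intro exI[of _ ?B]) (simp add: typeI_def)
qed

text \<open>Near the Gauss point classical points b satisfy |b| < 1 and |b - a| > 1/2. If |a| \<le>
  1 the distance is |a - b|; if |a| > 1 or \<open>x\<close> is infinity it is 1.\<close>

lemma gauss_nhd:
  assumes \<eta>: "mult_seminorm v \<eta>" "\<And>a. \<eta> [:- a, 1:] = max r (v a)" and r: "1 / 2 < r" "r < 1"
  shows "\<exists>W. openin (berk_P1 v) W \<and> Some \<eta> \<in> W \<and> (\<forall>y. typeI v y \<in> W \<longrightarrow> sph_dist v x y \<ge> 1 / 2)"
proof -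
  \<comment> \<open>For infinity the centre 0 is only a placeholder.\<close>
  define a where "a = (case x of None \<Rightarrow> 0 | Some a \<Rightarrow> a)"
  let ?U = "{\<zeta>. mult_seminorm v \<zeta> \<and> \<zeta> [:0, 1:] < 1} \<inter> {\<zeta>. mult_seminorm v \<zeta> \<and> \<zeta> [:- a, 1:] > 1 / 2}"
  have "sph_dist v x y \<ge> 1 / 2" if y: "typeI v y \<in> Some ` ?U" for y
  proof -
    obtain b where b: "y = Some b" "v b < 1" "v (b - a) > 1 / 2" using y by (cases y) (auto simp: typeI_def)
    show ?thesis
    proof (cases x)
      case None
      thus ?thesis using b by simp
    next
      case (Some a')
      hence s: "sph_dist v x y = v (a - b) / max 1 (v a)" using b by (simp add: a_def)
      show ?thesis
      proof (cases "v a \<le> 1")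
        case True
        thus ?thesis using b(3) by (simp add: s v_simps(8)[of a b])
      next
        case False
        hence "v (a - b) = v a" using v_add_eq[of "- b" a] b(2) by (simp add: v_simps(7))
        thus ?thesis using False by (simp add: s)
      qed
    qed
  qed
  moreover have "openin (berk_P1 v) (Some ` ?U)"
    by (intro openin_image_Some openin_Int openin_berk_A1_less openin_berk_A1_greater)
  moreover have "Some \<eta> \<in> Some ` ?U" using \<eta>(1) \<eta>(2)[of a] \<eta>(2)[of 0] r by (simp add: v_simps(5) less_max_iff_disj)
  ultimately show ?thesis by blast
qed

section \<open>The two inclusions between the Fatou sets\<close>

lemma classical_Fatou_imp_berk_Fatou:
  assumes \<tau>: "\<tau> \<in> Aut_star v" and x: "x \<in> classical_Fatou v \<phi> \<tau>"
  shows "typeI v x \<in> berk_Fatou v \<phi> \<tau>"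
proof -
  let ?f = "twisted_map \<phi> \<tau>" and ?F = "berk_twisted_map v \<phi> \<tau>"
  obtain U where U: "neighborhood (sph_topology v) x U"
    "equicontinuous_on (sph_dist v) (\<lambda>n. ?f ^^ n) U" using x by (auto simp: classical_Fatou_def)
  obtain e where e: "e > 0" "\<And>y. sph_dist v x y < e \<Longrightarrow> y \<in> U"
    using U(1) unfolding neighborhood_sph_iff by blast
  have "x \<in> U" using e by (simp add: sph_dist_self)
  then obtain d where d: "d > 0"
    "\<And>n y. y \<in> U \<Longrightarrow> sph_dist v x y < d \<Longrightarrow> sph_dist v ((?f ^^ n) x) ((?f ^^ n) y) < 1 / 2"
    using U(2) unfolding equicontinuous_on_def by (metis half_gt_zero zero_less_one)
  obtain B where B: "openin (berk_P1 v) B" "typeI v x \<in> B" "\<And>y. typeI v y \<in> B \<Longrightarrow> sph_dist v x y < min d e"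
    using berk_nhd_in_sph_ball[of "min d e" x] d(1) e(1) by auto
  obtain \<eta> where \<eta>: "\<And>r. r \<ge> 0 \<Longrightarrow> mult_seminorm v (\<eta> r)"
    "\<And>r a. r \<ge> 0 \<Longrightarrow> \<eta> r [:- a, 1:] = max r (v a)" using ex_gauss_seminorm by metis
  have omit: "Some (\<eta> r) \<notin> (?F ^^ n) ` B" if r: "1 / 2 < r" "r < 1" for r n
  proof
    assume "Some (\<eta> r) \<in> (?F ^^ n) ` B"
    then obtain \<zeta> where \<zeta>: "\<zeta> \<in> B" "(?F ^^ n) \<zeta> = Some (\<eta> r)" by auto
    obtain W where W: "openin (berk_P1 v) W" "Some (\<eta> r) \<in> W"
      "\<And>y. typeI v y \<in> W \<Longrightarrow> sph_dist v ((?f ^^ n) x) y \<ge> 1 / 2"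
      using gauss_nhd[OF \<eta>(1) \<eta>(2) r, of "(?f ^^ n) x"] r by auto
    \<comment> \<open>This open set contains \<zeta>, hence also a classical point, whose image
      would be both within 1/2 of the orbit of \<open>x\<close> and at least 1/2 away from
      it.\<close>
    let ?V = "{\<zeta> \<in> topspace (berk_P1 v). (?F ^^ n) \<zeta> \<in> W} \<inter> B"
    have "openin (berk_P1 v) ?V"
      by (intro openin_Int B(1) openin_continuous_map_preimage[OF continuous_map_berk_twisted_iterate[OF \<tau>] W(1)])
    moreover have "\<zeta> \<in> ?V" using \<zeta> W(2) B(1) openin_subset by fastforce
    ultimately obtain y where "typeI v y \<in> ?V" using typeI_dense_P1 by blast
    hence y: "typeI v y \<in> B" "typeI v ((?f ^^ n) y) \<in> W" by (auto simp: berk_twisted_iterate_typeI[OF \<tau>])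
    show False using d(2)[OF e(2), of y n] B(3)[OF y(1)] W(3)[OF y(2)] by simp
  qed
  let ?S = "topspace (berk_P1 v) - (\<Union>n. (?F ^^ n) ` B)"
  have "inj_on (\<lambda>r. Some (\<eta> r)) {1/2<..<1::real}"
  proof (rule inj_onI)
    fix r s :: real assume rs: "r \<in> {1/2<..<1}" "s \<in> {1/2<..<1}" "Some (\<eta> r) = Some (\<eta> s)"
    hence "\<eta> r [:- 0, 1:] = \<eta> s [:- 0, 1:]" by simp
    thus "r = s" using rs(1,2) \<eta>(2)[of r 0] \<eta>(2)[of s 0] by (simp add: v_simps(5))
  qed
  moreover have "infinite {1/2<..<1::real}" by (simp add: infinite_Ioo)
  moreover have "(\<lambda>r. Some (\<eta> r)) ` {1/2<..<1} \<subseteq> ?S"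
  proof (rule image_subsetI)
    fix r :: real assume r: "r \<in> {1/2<..<1}"
    have "Some (\<eta> r) \<in> topspace (berk_P1 v)" using r \<eta>(1)[of r] by (simp add: topspace_berk_P1)
    thus "Some (\<eta> r) \<in> ?S" using omit[of r] r by simp
  qed
  ultimately have "infinite ?S" by (meson finite_imageD infinite_super)
  moreover have "neighborhood (berk_P1 v) (typeI v x) B"
    using B(1,2) openin_subset[OF B(1)] unfolding neighborhood_def by blast
  moreover have "typeI v x \<in> topspace (berk_P1 v)" using range_typeI_subset[OF nonarch] by blast
  ultimately show ?thesis unfolding berk_Fatou_def mem_Collect_eq by (intro conjI exI[of _ B])
qed

text \<open>A radius s between the two distances to a puts \<zeta> inside and \<eta> outside the
  circle. The ultrametric inequality then separates classical points on the two sides by more than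
  s; the outer radius \<open>T\<close> keeps them bounded.\<close>

lemma berk_separate:
  assumes s: "mult_seminorm v \<zeta>" "mult_seminorm v \<eta>" and a: "\<zeta> [:- a, 1:] < \<eta> [:- a, 1:]"
  obtains U V s M where "openin (berk_P1 v) U" "openin (berk_P1 v) V" "Some \<zeta> \<in> U" "Some \<eta> \<in> V"
    "s > 0" "M \<ge> 1"
    "\<forall>b. typeI v b \<in> U \<longrightarrow> (\<exists>x. b = Some x \<and> v x \<le> M)"
    "\<forall>c. typeI v c \<in> V \<longrightarrow> (\<exists>x. c = Some x \<and> v x \<le> M)"
    "\<forall>b c. typeI v (Some b) \<in> U \<longrightarrow> typeI v (Some c) \<in> V \<longrightarrow> v (b - c) > s"
proof -
  obtain s where sd: "\<zeta> [:- a, 1:] < s" "s < \<eta> [:- a, 1:]" using dense[OF a] by blast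
  define T where "T = \<eta> [:- a, 1:] + 1"
  define M where "M = max (max T (v a)) 1"
  let ?U = "{\<xi>. mult_seminorm v \<xi> \<and> \<xi> [:- a, 1:] < s}"
  let ?V = "{\<xi>. mult_seminorm v \<xi> \<and> \<xi> [:- a, 1:] > s} \<inter> {\<xi>. mult_seminorm v \<xi> \<and> \<xi> [:- a, 1:] < T}"
  have s0: "s > 0" using sd(1) mult_seminormD(1)[OF nonarch s(1), of "[:- a, 1:]"] by linarith
  have bound: "v b \<le> M" if "v (b - a) < T" for b
    using v_simps(4)[of "b - a" a] that by (auto simp: M_def)
  have sep: "v (b - c) > s" if "v (b - a) < s" "v (c - a) > s" for b c
  proof -
    have "v ((b - a) + (a - c)) = v (a - c)" using that v_simps(8)[of c a] by (intro v_add_eq) simp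
    thus ?thesis using that v_simps(8)[of c a] by simp
  qed
  show ?thesis
  proof (rule that[of "Some ` ?U" "Some ` ?V" s M])
    show "openin (berk_P1 v) (Some ` ?U)" by (intro openin_image_Some openin_berk_A1_less)
    show "openin (berk_P1 v) (Some ` ?V)"
      by (intro openin_image_Some openin_Int openin_berk_A1_less openin_berk_A1_greater)
    show "\<forall>b. typeI v b \<in> Some ` ?U \<longrightarrow> (\<exists>x. b = Some x \<and> v x \<le> M)"
      using bound sd(2) by (auto simp: typeI_def T_def)
    show "\<forall>c. typeI v c \<in> Some ` ?V \<longrightarrow> (\<exists>x. c = Some x \<and> v x \<le> M)"
      using bound by (auto simp: typeI_def)
    show "\<forall>b c. typeI v (Some b) \<in> Some ` ?U \<longrightarrow> typeI v (Some c) \<in> Some ` ?V \<longrightarrow> v (b - c) > s"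
      using sep by (auto simp: typeI_def)
  qed (use s sd s0 in \<open>auto simp: T_def M_def\<close>)
qed

text \<open>The image of a compact Berkovich disk is closed, so it omits classical points
  arbitrarily close to any omitted point.\<close>

lemma ex_omitted_typeI:
  assumes \<tau>: "\<tau> \<in> Aut_star v" and D: "closedin (berk_P1 v) D"
    and N: "openin (berk_P1 v) N" "\<zeta> \<in> N" "\<zeta> \<notin> (berk_twisted_map v \<phi> \<tau> ^^ n) ` D"
  shows "\<exists>b. typeI v b \<in> N \<and> (\<forall>y. typeI v y \<in> D \<longrightarrow> (twisted_map \<phi> \<tau> ^^ n) y \<noteq> b)"
proof -
  let ?E = "(berk_twisted_map v \<phi> \<tau> ^^ n) ` D"
  have "compactin (berk_P1 v) D" using compact_berk_P1 D by (simp add: closedin_compact_space)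
  hence "compactin (berk_P1 v) ?E"
    by (rule image_compactin[OF _ continuous_map_berk_twisted_iterate[OF \<tau>]])
  hence "closedin (berk_P1 v) ?E" by (rule compactin_imp_closedin[OF Hausdorff_berk_P1])
  hence "openin (berk_P1 v) (N - ?E)" using N(1) by (rule openin_diff[rotated])
  then obtain b where "typeI v b \<in> N - ?E" using typeI_dense_P1 N by blast
  thus ?thesis using berk_twisted_iterate_typeI[OF \<tau>] by (metis DiffE imageI)
qed

lemma berk_Fatou_imp_classical_Fatou:
  assumes \<tau>: "\<tau> \<in> Aut_star v" and \<lambda>: "twist_exp v \<tau> \<ge> 1" and x: "typeI v x \<in> berk_Fatou v \<phi> \<tau>"
  shows "x \<in> classical_Fatou v \<phi> \<tau>"
proof -
  let ?f = "twisted_map \<phi> \<tau>" and ?F = "berk_twisted_map v \<phi> \<tau>"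
  have aut: "field_automorphism \<tau>" using \<tau> by (simp add: Aut_star_def)
  obtain U where U: "neighborhood (berk_P1 v) (typeI v x) U"
    "infinite (topspace (berk_P1 v) - (\<Union>n. (?F ^^ n) ` U))" using x by (auto simp: berk_Fatou_def)
  let ?S = "topspace (berk_P1 v) - (\<Union>n. (?F ^^ n) ` U)"
  obtain W where W: "openin (berk_P1 v) W" "typeI v x \<in> W" "W \<subseteq> U" using U(1) by (auto simp: neighborhood_def)
  obtain r D where r: "0 < r" "r \<le> 1" and D: "closedin (berk_P1 v) D" "D \<subseteq> W"
    "\<And>t. v t \<le> r \<Longrightarrow> typeI v (chart_pt x t) \<in> D" using berk_chart_nhd[OF W(1,2)] by blast
  \<comment> \<open>Infinity is discarded so that both omitted points are seminorms and can be
    compared on linear polynomials.\<close>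
  have inf: "infinite (?S - {None})" using U(2) by simp
  then obtain P1 where P1: "P1 \<in> ?S - {None}" using infinite_imp_nonempty by blast
  have "infinite (?S - {None} - {P1})" using inf by simp
  then obtain P2 where P2: "P2 \<in> ?S - {None} - {P1}" using infinite_imp_nonempty by blast
  obtain \<zeta> \<eta> a where P: "mult_seminorm v \<zeta>" "mult_seminorm v \<eta>" "\<zeta> [:- a, 1:] < \<eta> [:- a, 1:]"
    "Some \<zeta> \<in> ?S" "Some \<eta> \<in> ?S"
  proof -
    obtain \<zeta> \<eta> where P: "P1 = Some \<zeta>" "P2 = Some \<eta>" using P1 P2 by auto
    have S: "Some \<zeta> \<in> ?S" "Some \<eta> \<in> ?S" using P1 P2 unfolding P by blast+
    hence s: "mult_seminorm v \<zeta>" "mult_seminorm v \<eta>" by (auto simp: topspace_berk_P1)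
    have "\<zeta> \<noteq> \<eta>" using P1 P2 unfolding P by blast
    then obtain a where "\<zeta> [:- a, 1:] \<noteq> \<eta> [:- a, 1:]"
      using mult_seminorm_eq_iff_linear[OF s] by blast
    hence "\<zeta> [:- a, 1:] < \<eta> [:- a, 1:] \<or> \<eta> [:- a, 1:] < \<zeta> [:- a, 1:]" by linarith
    thus ?thesis
    proof
      assume "\<zeta> [:- a, 1:] < \<eta> [:- a, 1:]"
      thus ?thesis by (rule that[OF s _ S])
    next
      assume "\<eta> [:- a, 1:] < \<zeta> [:- a, 1:]"
      thus ?thesis by (rule that[OF s(2,1) _ S(2,1)])
    qed
  qed
  obtain N1 N2 s M where N: "openin (berk_P1 v) N1" "openin (berk_P1 v) N2"
    "Some \<zeta> \<in> N1" "Some \<eta> \<in> N2" "s > 0" "M \<ge> 1"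
    "\<forall>b. typeI v b \<in> N1 \<longrightarrow> (\<exists>x. b = Some x \<and> v x \<le> M)"
    "\<forall>c. typeI v c \<in> N2 \<longrightarrow> (\<exists>x. c = Some x \<and> v x \<le> M)"
    "\<forall>b c. typeI v (Some b) \<in> N1 \<longrightarrow> typeI v (Some c) \<in> N2 \<longrightarrow> v (b - c) > s"
    by (rule berk_separate[OF P(1-3)])
  have "(?F ^^ n) ` D \<subseteq> (\<Union>n. (?F ^^ n) ` U)" for n using D(2) W(3) by blast
  hence omit: "Some \<zeta> \<notin> (?F ^^ n) ` D" "Some \<eta> \<notin> (?F ^^ n) ` D" for n
    using P(4,5) by (meson DiffD2 subsetD)+
  \<comment> \<open>The omitted classical points chosen below depend on \<open>n\<close>, but their
    bound \<open>M\<close> and separation \<open>s\<close> do not; hence neither does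
    \<open>L\<close>.\<close>
  define L where "L = M\<^sup>2 / s / r"
  have L: "L > 0" using N(5,6) r(1) by (simp add: L_def)
  have lip: "sph_dist v ((?f ^^ n) (chart_pt x t)) ((?f ^^ n) (chart_pt x t')) \<le> L * v (t - t')"
    if t: "v t \<le> r" "v t' \<le> r" for n t t'
  proof -
    obtain b' where b': "typeI v b' \<in> N1" "\<And>y. typeI v y \<in> D \<Longrightarrow> (?f ^^ n) y \<noteq> b'"
      using ex_omitted_typeI[OF \<tau> D(1) N(1,3) omit(1)] by blast
    obtain c' where c': "typeI v c' \<in> N2" "\<And>y. typeI v y \<in> D \<Longrightarrow> (?f ^^ n) y \<noteq> c'"
      using ex_omitted_typeI[OF \<tau> D(1) N(2,4) omit(2)] by blast
    obtain b where b: "b' = Some b" "v b \<le> M" using N(7) b'(1) by blast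
    obtain c where c: "c' = Some c" "v c \<le> M" using N(8) c'(1) by blast
    have bc: "v (b - c) > s" using N(9) b'(1) c'(1) unfolding b c by blast
    obtain P Q where PQ: "\<And>t. poly P t \<noteq> 0 \<or> poly Q t \<noteq> 0"
      "\<And>t. (?f ^^ n) (chart_pt x t) = proj_pt (poly P ((\<tau> ^^ n) t)) (poly Q ((\<tau> ^^ n) t))"
      unfolding chart_pt_def using twisted_iterate_proj_pt[OF aut chart_nonzero] by blast
    define l where "l = twist_exp v \<tau> ^ n"
    have l: "l \<ge> 1" using \<lambda> by (simp add: l_def one_le_power)
    have vt: "v ((\<tau> ^^ n) t) = v t powr l" for t by (simp add: l_def twist_iterate_abs[OF \<tau>])
    have vt_le: "v ((\<tau> ^^ n) t) \<le> r powr l \<longleftrightarrow> v t \<le> r" for t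
    proof (cases "v t \<le> r")
      case True
      thus ?thesis using powr_mono2[of l "v t" r] l v_simps(1)[of t] by (simp add: vt)
    next
      case False
      thus ?thesis using powr_less_mono2[of l r "v t"] l r(1) by (simp add: vt)
    qed
    \<comment> \<open>Surjectivity of \<open>\<tau> ^^ n\<close> and \<open>vt_le\<close> identify
      the disk of radius \<open>r powr l\<close> with the image of the disk of radius
      \<open>r\<close>.\<close>
    have avoid: "proj_pt (poly P s) (poly Q s) \<noteq> Some b" "proj_pt (poly P s) (poly Q s) \<noteq> Some c"
      if "v s \<le> r powr l" for s
    proof -
      obtain u where u: "s = (\<tau> ^^ n) u" using field_automorphism_funpow(2)[OF aut, of n] by (metis surjD)
      hence "v u \<le> r" using that vt_le by simp
      thus "proj_pt (poly P s) (poly Q s) \<noteq> Some b" "proj_pt (poly P s) (poly Q s) \<noteq> Some c"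
        unfolding u PQ(2)[symmetric] using b'(2)[OF D(3)] c'(2)[OF D(3)] b(1) c(1) by simp_all
    qed
    have "r powr l > 0" using r(1) by simp
    moreover have "b \<noteq> c" using bc N(5) by (auto simp: v_simps(5))
    ultimately have "sph_dist v ((?f ^^ n) (chart_pt x t)) ((?f ^^ n) (chart_pt x t')) \<le>
      M\<^sup>2 / v (b - c) * (v ((\<tau> ^^ n) t - (\<tau> ^^ n) t') / r powr l)"
      unfolding PQ(2) using t b(2) c(2) N(6) PQ(1)
      by (intro sph_dist_omitting[OF _ _ _ _ avoid]) (simp_all add: vt_le)
    also have "v ((\<tau> ^^ n) t - (\<tau> ^^ n) t') / r powr l = (v (t - t') / r) powr l"
      using r(1) v_simps(1) by (simp add: vt powr_divide flip: field_automorphism_funpow(1)[OF aut])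
    also have "M\<^sup>2 / v (b - c) * (v (t - t') / r) powr l \<le> M\<^sup>2 / s * (v (t - t') / r)"
    proof (intro mult_mono)
      show "M\<^sup>2 / v (b - c) \<le> M\<^sup>2 / s" using bc N(5) by (intro divide_left_mono mult_pos_pos) auto
      have "v (t - t') \<le> r" using v_diff_le[of t t'] t by linarith
      hence "v (t - t') / r \<le> 1" "v (t - t') / r \<ge> 0" using r(1) v_simps(1) by auto
      \<comment> \<open>Here \<lambda> \<ge> 1 enters: raising a number in [0, 1] to a power
        \<open>l \<ge> 1\<close> does not increase it.\<close>
      thus "(v (t - t') / r) powr l \<le> v (t - t') / r" using powr_mono'[of 1 l "v (t - t') / r"] l by simp
    qed (use N(5) in auto)
    finally show ?thesis by (simp add: L_def)
  qed
  obtain C where C: "C \<ge> 1" "\<And>t t'. v t \<le> 1 \<Longrightarrow> v t' \<le> 1 \<Longrightarrow>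
      v (t - t') \<le> C * sph_dist v (chart_pt x t) (chart_pt x t')" using chart_dist by blast
  obtain e where e: "e > 0" "\<And>y. sph_dist v x y < e \<Longrightarrow> \<exists>t. v t < r \<and> y = chart_pt x t"
    using chart_surj[OF r] by blast
  let ?B = "{y. sph_dist v x y < e}"
  have lip': "sph_dist v ((?f ^^ n) y) ((?f ^^ n) y') \<le> L * C * sph_dist v y y'" if B: "y \<in> ?B" "y' \<in> ?B" for n y y'
  proof -
    obtain t where t: "v t < r" "y = chart_pt x t" using e(2)[of y] B(1) by blast
    obtain t' where t': "v t' < r" "y' = chart_pt x t'" using e(2)[of y'] B(2) by blast
    have "v (t - t') \<le> C * sph_dist v y y'" unfolding t(2) t'(2) using t(1) t'(1) r(2) by (intro C(2)) auto
    from mult_left_mono[OF this less_imp_le[OF L]] show ?thesis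
      using lip[of t t' n] t(1) t'(1) unfolding t(2) t'(2) by (simp add: mult.assoc)
  qed
  have LC: "L * C > 0" using L C(1) by simp
  have "equicontinuous_on (sph_dist v) (\<lambda>n. ?f ^^ n) ?B"
    unfolding equicontinuous_on_def
  proof (intro ballI allI impI)
    fix \<epsilon> :: real and z assume "z \<in> ?B" "\<epsilon> > 0"
    show "\<exists>\<delta>>0. \<forall>n. \<forall>y\<in>?B. sph_dist v z y < \<delta> \<longrightarrow> sph_dist v ((?f ^^ n) z) ((?f ^^ n) y) < \<epsilon>"
    proof (intro exI[of _ "\<epsilon> / (L * C)"] conjI allI ballI impI)
      fix n y assume y: "y \<in> ?B" "sph_dist v z y < \<epsilon> / (L * C)"
      have "L * C * sph_dist v z y < \<epsilon>" using y(2) LC by (simp only: pos_less_divide_eq mult.commute)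
      thus "sph_dist v ((?f ^^ n) z) ((?f ^^ n) y) < \<epsilon>" using lip'[OF \<open>z \<in> ?B\<close> y(1), of n] by linarith
    qed (use \<open>\<epsilon> > 0\<close> LC in simp)
  qed
  moreover have "neighborhood (sph_topology v) x ?B" unfolding neighborhood_sph_iff using e(1) by blast
  ultimately show ?thesis unfolding classical_Fatou_def by blast
qed

end

theorem theorem1p1:
  fixes v :: "'a::{alg_closed_field, field_char_0} \<Rightarrow> real"
    and \<tau> :: "'a \<Rightarrow> 'a" and \<phi> :: "'a poly fract"
  assumes "nonarch_abs v" and "nontrivial_abs v" and "complete_abs v"
    and "\<tau> \<in> Aut_star v" and "rat_degree \<phi> \<ge> 1"
  shows "typeI v ` classical_Fatou v \<phi> \<tau> \<subseteq> berk_Fatou v \<phi> \<tau> \<inter> range (typeI v) \<and>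
         typeI v ` classical_Julia v \<phi> \<tau> \<supseteq> berk_Julia v \<phi> \<tau> \<inter> range (typeI v) \<and>
         (twist_exp v \<tau> \<ge> 1 \<longrightarrow>
           typeI v ` classical_Fatou v \<phi> \<tau> = berk_Fatou v \<phi> \<tau> \<inter> range (typeI v) \<and>
           typeI v ` classical_Julia v \<phi> \<tau> = berk_Julia v \<phi> \<tau> \<inter> range (typeI v))"
proof -
  interpret nonarch_field v using assms by unfold_locales
  have 1: "typeI v x \<in> berk_Fatou v \<phi> \<tau>" if "x \<in> classical_Fatou v \<phi> \<tau>" for x
    using classical_Fatou_imp_berk_Fatou[OF assms(4) that] .
  have 2: "x \<in> classical_Fatou v \<phi> \<tau>" if "twist_exp v \<tau> \<ge> 1" "typeI v x \<in> berk_Fatou v \<phi> \<tau>" for x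
    using berk_Fatou_imp_classical_Fatou[OF assms(4) that] .
  have 3: "typeI v x \<in> topspace (berk_P1 v)" for x using range_typeI_subset[OF nonarch] by blast
  \<comment> \<open>The Julia statements are the contrapositives of the Fatou statements on
    classical points.\<close>
  show ?thesis unfolding classical_Julia_def berk_Julia_def using 1 2 3 by blast
qed

end
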